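(* Let $m,n,k$ be non-negative integers with $1\le k\le n$. The sum over all $(m,n,k)$-Magog trapezoids of $P^{\#\text{maxima}}Q^{\#\text{minima}}$ equals the constant term in $x_1,\dots,x_n$ of $$(-1)^{(m-1)n+\binom{n+1}{2}}\Bigl((-1)^kQ(1+x_{n-k+1}^{-1})\prod_{j=n-k+2}^n(x_j^{-1}-x_{n-k+1})+1\Bigr)\prod_{i=1}^{n-k}(1+x_i)^{-i-k}x_i^{-m-2n+i+1}\bigl(x_i-P(1+x_i)\bigr)\bigl(x_i-Q(1+x_i)\bigr)$$ $$\times\prod_{i=n-k+1}^n(1+x_i)^{-n-1}x_i^{-m-2n+i+2}\bigl(x_i-P(1+x_i)\bigr)\prod_{1\le i<j\le n}(x_i-x_j)(x_i+x_j+x_ix_j)\prod_{n-k+1\le i<j\le n}\frac{1}{1-x_ix_j}.$$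
   Context: For non-negative integers $m,n,k$ with $k\le n$, an $(m,n,k)$-Magog trapezoid is an array $(m_{i,j})$ of positive integers indexed by $1\le j\le i\le n$ with $i-j\le k-1$ (the $k$ rightmost SE-diagonals of a triangular array with $n$ rows), such that $m_{i+1,j}\le m_{i,j}\le m_{i+1,j+1}$ whenever these entries exist and $m_{i,j}\le m+j$. A minimum is an entry equal to $1$ in the leftmost SE-diagonal $\{m_{i,j}:i-j=k-1\}$; a maximum is an entry $m_{j,j}$ with $m_{j,j}=m+j$. $P,Q$ are indeterminates. Negative powers of $(1+x_i)$ and the factors $\frac1{1-x_ix_j}$ are expanded as power series in the $x_i$ with non-negative exponents. *)

theory Defs
  imports
    "HOL-Library.Poly_Mapping"
    "HOL-Computational_Algebra.Polynomial"
begin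

section \<open>Formal Laurent series in several variables\<close>

text \<open>
  A series in the variables \<open>x\<^sub>0, x\<^sub>1, \<dots>\<close> is given by its coefficient function on the exponent
  vectors, which have type \<^typ>\<open>nat \<Rightarrow>\<^sub>0 int\<close>. Each series involves only finitely many variables,
  and its exponents have a common lower bound. Hence products are finite sums coefficientwise.
\<close>

definition expo_box :: "nat set \<Rightarrow> int \<Rightarrow> (nat \<Rightarrow>\<^sub>0 int) set" where
  "expo_box V N = {e. Poly_Mapping.keys e \<subseteq> V \<and> (\<forall>i. N \<le> Poly_Mapping.lookup e i)}"

definition laurent_supp :: "((nat \<Rightarrow>\<^sub>0 int) \<Rightarrow> 'a::zero) \<Rightarrow> bool" where
  "laurent_supp f \<longleftrightarrow> (\<exists>V N. finite V \<and> {e. f e \<noteq> 0} \<subseteq> expo_box V N)"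

typedef (overloaded) 'a mlaurent = "{f :: (nat \<Rightarrow>\<^sub>0 int) \<Rightarrow> 'a::zero. laurent_supp f}"
  morphisms mcoeff Abs_mlaurent
  by (rule exI[of _ "\<lambda>_. 0"]) (auto simp: laurent_supp_def)

lifting_forget poly_mapping.lifting

setup_lifting type_definition_mlaurent

lemma expo_box_mono: "V \<subseteq> W \<Longrightarrow> M \<le> N \<Longrightarrow> expo_box V N \<subseteq> expo_box W M"
  by (auto simp: expo_box_def intro: order_trans)

lemma expo_box_add:
  assumes "a \<in> expo_box V N" "b \<in> expo_box V M"
  shows "a + b \<in> expo_box V (N + M)"
  using assms Poly_Mapping.keys_add[of a b]
  by (fastforce simp: expo_box_def lookup_add intro: add_mono)

lemma laurent_suppI: "finite V \<Longrightarrow> (\<And>e. f e \<noteq> 0 \<Longrightarrow> e \<in> expo_box V N) \<Longrightarrow> laurent_supp f"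
  unfolding laurent_supp_def by blast

lemma laurent_supp_common2:
  assumes "laurent_supp f" "laurent_supp g"
  obtains V N where "finite V" "\<And>e. f e \<noteq> 0 \<Longrightarrow> e \<in> expo_box V N"
    "\<And>e. g e \<noteq> 0 \<Longrightarrow> e \<in> expo_box V N"
proof -
  from assms obtain V N W M where *: "finite V" "finite W"
    "{e. f e \<noteq> 0} \<subseteq> expo_box V N" "{e. g e \<noteq> 0} \<subseteq> expo_box W M"
    unfolding laurent_supp_def by blast
  have "expo_box V N \<subseteq> expo_box (V \<union> W) (min N M)" "expo_box W M \<subseteq> expo_box (V \<union> W) (min N M)"
    by (rule expo_box_mono; simp)+
  with * show ?thesis by (intro that[of "V \<union> W" "min N M"]) auto
qed

lemma finite_expo_box_diff:
  assumes "finite V"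
  shows "finite {a \<in> expo_box V N. e - a \<in> expo_box V M}"
proof -
  let ?S = "{a \<in> expo_box V N. e - a \<in> expo_box V M}"
  let ?L = "Min (insert 0 ((\<lambda>i. Poly_Mapping.lookup e i - M) ` V))"
  let ?U = "Max (insert 0 ((\<lambda>i. Poly_Mapping.lookup e i - M) ` V))"
  have "Poly_Mapping.lookup ` ?S \<subseteq>
      {f. (\<forall>i. (i \<in> V \<longrightarrow> f i \<in> {N..?U}) \<and> (i \<notin> V \<longrightarrow> f i = 0))}"
  proof safe
    fix a i assume a: "a \<in> expo_box V N" "e - a \<in> expo_box V M" and i: "i \<in> V"
    have "Poly_Mapping.lookup a i \<le> Poly_Mapping.lookup e i - M"
      using a by (auto simp: expo_box_def lookup_minus le_diff_eq algebra_simps)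
    also have "\<dots> \<le> ?U" using i assms by (intro Max_ge) auto
    finally show "Poly_Mapping.lookup a i \<in> {N..?U}" using a by (auto simp: expo_box_def)
  next
    fix a i assume "a \<in> expo_box V N" "i \<notin> V"
    then show "Poly_Mapping.lookup a i = 0" by (auto simp: expo_box_def in_keys_iff)
  qed
  moreover have "finite {f. (\<forall>i. (i \<in> V \<longrightarrow> f i \<in> {N..?U}) \<and> (i \<notin> V \<longrightarrow> f i = (0::int)))}"
    using assms by (intro finite_set_of_finite_funs) auto
  ultimately have "finite (Poly_Mapping.lookup ` ?S)" by (rule finite_subset)
  then show ?thesis by (rule finite_imageD) (auto intro: inj_onI simp: lookup_inject)
qed

definition conv :: "((nat \<Rightarrow>\<^sub>0 int) \<Rightarrow> 'a) \<Rightarrow> ((nat \<Rightarrow>\<^sub>0 int) \<Rightarrow> 'a) \<Rightarrow> (nat \<Rightarrow>\<^sub>0 int) \<Rightarrow> 'a::comm_ring_1"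
  where "conv f g e = (\<Sum>a | f a \<noteq> 0 \<and> g (e - a) \<noteq> 0. f a * g (e - a))"

lemma conv_superset:
  assumes "finite S" "\<And>a. f a \<noteq> 0 \<Longrightarrow> g (e - a) \<noteq> 0 \<Longrightarrow> a \<in> S"
  shows "conv f g e = (\<Sum>a\<in>S. f a * g (e - a))"
  unfolding conv_def using assms by (intro sum.mono_neutral_left) auto

lemma conv_nonzeroE:
  assumes "conv f g e \<noteq> 0"
  obtains a where "f a \<noteq> 0" "g (e - a) \<noteq> 0"
proof -
  have "{a. f a \<noteq> 0 \<and> g (e - a) \<noteq> 0} \<noteq> {}"
    using assms unfolding conv_def by (metis sum.empty)
  then show ?thesis using that by blast
qed

lemma conv_nonzero_box:
  assumes "\<And>e. f e \<noteq> 0 \<Longrightarrow> e \<in> expo_box V N" "\<And>e. g e \<noteq> 0 \<Longrightarrow> e \<in> expo_box V M"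
  assumes "conv f g e \<noteq> 0"
  shows "e \<in> expo_box V (N + M)"
  using assms(3)
proof (rule conv_nonzeroE)
  fix a assume "f a \<noteq> 0" "g (e - a) \<noteq> 0"
  then have "a + (e - a) \<in> expo_box V (N + M)" by (intro expo_box_add assms)
  then show ?thesis by simp
qed

lemma conv_box:
  assumes "finite V" "\<And>e. f e \<noteq> 0 \<Longrightarrow> e \<in> expo_box V N" "\<And>e. g e \<noteq> 0 \<Longrightarrow> e \<in> expo_box V M"
  shows "conv f g e = (\<Sum>a \<in> {a \<in> expo_box V N. e - a \<in> expo_box V M}. f a * g (e - a))"
  using assms by (intro conv_superset finite_expo_box_diff) auto

lemma laurent_supp_conv:
  assumes "laurent_supp f" "laurent_supp g"
  shows "laurent_supp (conv f g)"
proof (rule laurent_supp_common2[OF assms])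
  fix V N assume *: "finite V" "\<And>e. f e \<noteq> 0 \<Longrightarrow> e \<in> expo_box V N"
    "\<And>e. g e \<noteq> 0 \<Longrightarrow> e \<in> expo_box V N"
  show ?thesis by (rule laurent_suppI[OF *(1)]) (rule conv_nonzero_box[OF *(2,3)])
qed

lemma conv_commute: "conv f g = conv g f"
proof
  fix e
  show "conv f g e = conv g f e" unfolding conv_def
    by (rule sum.reindex_bij_witness[of _ "\<lambda>a. e - a" "\<lambda>a. e - a"]) (auto simp: mult.commute)
qed

lemma conv_add_left:
  assumes "laurent_supp f" "laurent_supp g" "laurent_supp h"
  shows "conv (\<lambda>e. f e + g e) h e = conv f h e + conv g h e"
proof (rule laurent_supp_common2[OF assms(1,2)])
  fix V N assume 1: "finite V" "\<And>e. f e \<noteq> 0 \<Longrightarrow> e \<in> expo_box V N"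
    "\<And>e. g e \<noteq> 0 \<Longrightarrow> e \<in> expo_box V N"
  obtain W M where 2: "finite W" "\<And>e. h e \<noteq> 0 \<Longrightarrow> e \<in> expo_box W M"
    using assms(3) unfolding laurent_supp_def by blast
  have 3: "expo_box V N \<subseteq> expo_box (V \<union> W) N" "expo_box W M \<subseteq> expo_box (V \<union> W) M"
    by (rule expo_box_mono; simp)+
  let ?S = "{a \<in> expo_box (V \<union> W) N. e - a \<in> expo_box (V \<union> W) M}"
  have fin: "finite ?S" using 1(1) 2(1) by (intro finite_expo_box_diff) auto
  have "conv f h e = (\<Sum>a\<in>?S. f a * h (e - a))"
    by (rule conv_superset[OF fin]) (use 1 2 3 in blast)
  moreover have "conv g h e = (\<Sum>a\<in>?S. g a * h (e - a))"
    by (rule conv_superset[OF fin]) (use 1 2 3 in blast)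
  moreover have "conv (\<lambda>e. f e + g e) h e = (\<Sum>a\<in>?S. (f a + g a) * h (e - a))"
  proof (rule conv_superset[OF fin])
    fix a assume "f a + g a \<noteq> 0" "h (e - a) \<noteq> 0"
    then have "f a \<noteq> 0 \<or> g a \<noteq> 0" by auto
    then show "a \<in> ?S" using 1 2 3 \<open>h (e - a) \<noteq> 0\<close> by blast
  qed
  ultimately show ?thesis by (simp add: sum.distrib distrib_right)
qed

lemma conv_assoc:
  assumes "laurent_supp f" "laurent_supp g" "laurent_supp h"
  shows "conv (conv f g) h e = conv f (conv g h) e"
proof -
  obtain V1 N1 where 1: "finite V1" "\<And>e. f e \<noteq> 0 \<Longrightarrow> e \<in> expo_box V1 N1"
    using assms(1) unfolding laurent_supp_def by blast
  obtain V2 N2 where 2: "finite V2" "\<And>e. g e \<noteq> 0 \<Longrightarrow> e \<in> expo_box V2 N2"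
    using assms(2) unfolding laurent_supp_def by blast
  obtain V3 N3 where 3: "finite V3" "\<And>e. h e \<noteq> 0 \<Longrightarrow> e \<in> expo_box V3 N3"
    using assms(3) unfolding laurent_supp_def by blast
  define V where "V = V1 \<union> V2 \<union> V3"
  have V: "finite V" using 1 2 3 by (simp add: V_def)
  have f: "e \<in> expo_box V N1" if "f e \<noteq> 0" for e
    using 1(2)[OF that] expo_box_mono[of V1 V N1 N1] by (auto simp: V_def)
  have g: "e \<in> expo_box V N2" if "g e \<noteq> 0" for e
    using 2(2)[OF that] expo_box_mono[of V2 V N2 N2] by (auto simp: V_def)
  have h: "e \<in> expo_box V N3" if "h e \<noteq> 0" for e
    using 3(2)[OF that] expo_box_mono[of V3 V N3 N3] by (auto simp: V_def)
  have fg: "e \<in> expo_box V (N1 + N2)" if "conv f g e \<noteq> 0" for e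
    using conv_nonzero_box[of f V N1 g N2 e, OF f g that] .
  have gh: "e \<in> expo_box V (N2 + N3)" if "conv g h e \<noteq> 0" for e
    using conv_nonzero_box[of g V N2 h N3 e, OF g h that] .
  let ?T = "{a \<in> expo_box V (N1 + N2). e - a \<in> expo_box V N3}"
  let ?S = "{b \<in> expo_box V N1. e - b \<in> expo_box V (N2 + N3)}"
  have fin: "finite ?S" "finite ?T" using V by (intro finite_expo_box_diff; simp)+
  have L: "conv f g a * h (e - a) = (\<Sum>b\<in>?S. f b * g (a - b) * h (e - a))" for a
  proof (cases "h (e - a) = 0")
    case False
    have "conv f g a = (\<Sum>b\<in>?S. f b * g (a - b))"
    proof (rule conv_superset[OF fin(1)])
      fix b assume b: "f b \<noteq> 0" "g (a - b) \<noteq> 0"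
      have "(a - b) + (e - a) \<in> expo_box V (N2 + N3)" using b False by (intro expo_box_add g h)
      then show "b \<in> ?S" using f[OF b(1)] by simp
    qed
    then show ?thesis by (simp add: sum_distrib_right)
  qed simp
  have R: "f b * conv g h (e - b) = (\<Sum>a\<in>?T. f b * (g (a - b) * h (e - a)))" for b
  proof (cases "f b = 0")
    case False
    have inj: "inj_on (\<lambda>a. a - b) ?T" by (auto intro: inj_onI)
    have "conv g h (e - b) = (\<Sum>c\<in>(\<lambda>a. a - b) ` ?T. g c * h (e - b - c))"
    proof (rule conv_superset)
      show "finite ((\<lambda>a. a - b) ` ?T)" using fin by simp
      fix c assume c: "g c \<noteq> 0" "h (e - b - c) \<noteq> 0"
      have "b + c \<in> expo_box V (N1 + N2)" using c False by (intro expo_box_add f g)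
      moreover have "e - (b + c) \<in> expo_box V N3" using h[OF c(2)] by (simp add: diff_diff_eq)
      ultimately show "c \<in> (\<lambda>a. a - b) ` ?T" by (intro image_eqI[of _ _ "b + c"]) auto
    qed
    also have "\<dots> = (\<Sum>a\<in>?T. g (a - b) * h (e - a))"
      by (subst sum.reindex[OF inj]) (simp add: algebra_simps)
    finally show ?thesis by (simp add: sum_distrib_left)
  qed simp
  have "conv (conv f g) h e = (\<Sum>a\<in>?T. conv f g a * h (e - a))"
    by (rule conv_box[OF V fg h])
  also have "\<dots> = (\<Sum>a\<in>?T. \<Sum>b\<in>?S. f b * g (a - b) * h (e - a))"
    by (simp only: L)
  also have "\<dots> = (\<Sum>b\<in>?S. \<Sum>a\<in>?T. f b * (g (a - b) * h (e - a)))"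
    by (subst sum.swap) (simp add: mult.assoc)
  also have "\<dots> = (\<Sum>b\<in>?S. f b * conv g h (e - b))"
    by (simp only: R)
  also have "\<dots> = conv f (conv g h) e"
    by (rule conv_box[OF V f gh, symmetric])
  finally show ?thesis .
qed

lemma laurent_supp_monom: "laurent_supp (\<lambda>e. if e = d then c else 0)"
proof (rule laurent_suppI)
  let ?N = "Min (insert 0 (Poly_Mapping.lookup d ` Poly_Mapping.keys d))"
  show "finite (Poly_Mapping.keys d)" by simp
  fix e :: "nat \<Rightarrow>\<^sub>0 int" assume "(if e = d then c else 0) \<noteq> 0"
  then have e: "e = d" by (auto split: if_splits)
  have "?N \<le> Poly_Mapping.lookup d i" for i
  proof (cases "i \<in> Poly_Mapping.keys d")
    case True
    then show ?thesis by (intro Min_le) auto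
  next
    case False
    then have "Poly_Mapping.lookup d i = 0" by (simp add: in_keys_iff)
    then show ?thesis by (simp add: Min_le)
  qed
  then show "e \<in> expo_box (Poly_Mapping.keys d) ?N" by (auto simp: expo_box_def e)
qed

lemma conv_monom_left: "conv (\<lambda>e. if e = d then c else 0) g e = c * g (e - d)"
  by (subst conv_superset[of "{d}"]) (auto split: if_splits)

instantiation mlaurent :: (comm_ring_1) comm_ring_1
begin

lift_definition zero_mlaurent :: "'a mlaurent" is "\<lambda>_. 0"
  by (auto simp: laurent_supp_def)

lift_definition one_mlaurent :: "'a mlaurent" is "\<lambda>e. if e = 0 then 1 else 0"
  by (rule laurent_supp_monom)

lift_definition plus_mlaurent :: "'a mlaurent \<Rightarrow> 'a mlaurent \<Rightarrow> 'a mlaurent"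
  is "\<lambda>f g e. f e + g e"
proof -
  fix f g :: "(nat \<Rightarrow>\<^sub>0 int) \<Rightarrow> 'a"
  assume supp: "laurent_supp f" "laurent_supp g"
  show "laurent_supp (\<lambda>e. f e + g e)"
  proof (rule laurent_supp_common2[OF supp])
    fix V N assume *: "finite V" "\<And>e. f e \<noteq> 0 \<Longrightarrow> e \<in> expo_box V N"
      "\<And>e. g e \<noteq> 0 \<Longrightarrow> e \<in> expo_box V N"
    show ?thesis
    proof (rule laurent_suppI[OF *(1)])
      fix e assume "f e + g e \<noteq> 0"
      then have "f e \<noteq> 0 \<or> g e \<noteq> 0" by auto
      then show "e \<in> expo_box V N" using *(2,3) by blast
    qed
  qed
qed

lift_definition uminus_mlaurent :: "'a mlaurent \<Rightarrow> 'a mlaurent" is "\<lambda>f e. - f e"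
  by (simp add: laurent_supp_def)

definition minus_mlaurent :: "'a mlaurent \<Rightarrow> 'a mlaurent \<Rightarrow> 'a mlaurent" where
  "minus_mlaurent f g = f + (- g)"

lift_definition times_mlaurent :: "'a mlaurent \<Rightarrow> 'a mlaurent \<Rightarrow> 'a mlaurent" is conv
  by (rule laurent_supp_conv)

instance
proof
  fix a b c :: "'a mlaurent"
  show "a + b + c = a + (b + c)" by transfer (simp add: add.assoc)
  show "a + b = b + a" by transfer (simp add: add.commute)
  show "0 + a = a" by transfer simp
  show "- a + a = 0" by transfer simp
  show "a - b = a + - b" by (rule minus_mlaurent_def)
  show "a * b * c = a * (b * c)" by transfer (auto simp: conv_assoc)
  show "a * b = b * a" by transfer (rule conv_commute)
  show "1 * a = a" by transfer (simp add: conv_monom_left fun_eq_iff)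
  show "(a + b) * c = a * c + b * c" by transfer (auto simp: conv_add_left)
  show "(0::'a mlaurent) \<noteq> 1" by transfer (metis zero_neq_one)
qed

end

definition const_term :: "'a::zero mlaurent \<Rightarrow> 'a" where
  "const_term f = mcoeff f 0"

lift_definition mmonom :: "'a \<Rightarrow> (nat \<Rightarrow>\<^sub>0 int) \<Rightarrow> 'a::comm_ring_1 mlaurent"
  is "\<lambda>c d e. if e = d then c else 0"
  by (rule laurent_supp_monom)

definition mconst :: "'a::comm_ring_1 \<Rightarrow> 'a mlaurent" where
  "mconst c = mmonom c 0"

text \<open>\<open>xpow i z\<close> is \<open>x\<^sub>i\<^sup>z\<close> for an arbitrary integer \<open>z\<close>.\<close>

definition xpow :: "nat \<Rightarrow> int \<Rightarrow> 'a::comm_ring_1 mlaurent" where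
  "xpow i z = mmonom 1 (Poly_Mapping.single i z)"

abbreviation xvar :: "nat \<Rightarrow> 'a::comm_ring_1 mlaurent" where
  "xvar i \<equiv> xpow i 1"

text \<open>\<open>inv_one_plus i\<close> is \<open>(1 + x\<^sub>i)\<^sup>-\<^sup>1 = \<Sum>r. (-1)\<^sup>r x\<^sub>i\<^sup>r\<close>.\<close>

lift_definition inv_one_plus :: "nat \<Rightarrow> 'a::comm_ring_1 mlaurent"
  is "\<lambda>i e. if \<exists>r. e = Poly_Mapping.single i (int r)
            then (-1) ^ nat (Poly_Mapping.lookup e i) else 0"
proof -
  fix i
  show "laurent_supp (\<lambda>e. if \<exists>r. e = Poly_Mapping.single i (int r)
            then (-1::'a) ^ nat (Poly_Mapping.lookup e i) else 0)"
    by (rule laurent_suppI[of "{i}" _ 0])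
      (auto simp: expo_box_def lookup_single when_def split: if_splits)
qed

text \<open>\<open>inv_one_minus_prod i j\<close> is \<open>1 / (1 - x\<^sub>i x\<^sub>j) = \<Sum>r. x\<^sub>i\<^sup>r x\<^sub>j\<^sup>r\<close>.\<close>

lift_definition inv_one_minus_prod :: "nat \<Rightarrow> nat \<Rightarrow> 'a::comm_ring_1 mlaurent"
  is "\<lambda>i j e. if \<exists>r. e = Poly_Mapping.single i (int r) + Poly_Mapping.single j (int r)
              then 1 else 0"
proof -
  fix i j
  show "laurent_supp (\<lambda>e. if \<exists>r. e = Poly_Mapping.single i (int r) + Poly_Mapping.single j (int r)
              then 1::'a else 0)"
  proof (rule laurent_suppI[of "{i, j}" _ 0])
    fix e :: "nat \<Rightarrow>\<^sub>0 int"
    assume "(if \<exists>r. e = Poly_Mapping.single i (int r) + Poly_Mapping.single j (int r)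
              then 1::'a else 0) \<noteq> 0"
    then obtain r where e: "e = Poly_Mapping.single i (int r) + Poly_Mapping.single j (int r)"
      by (auto split: if_splits)
    have "Poly_Mapping.single i (int r) \<in> expo_box {i, j} 0"
      "Poly_Mapping.single j (int r) \<in> expo_box {i, j} 0"
      by (auto simp: expo_box_def lookup_single when_def)
    then show "e \<in> expo_box {i, j} 0" unfolding e by (metis expo_box_add add_0)
  qed simp
qed

lemma mcoeff_mmonom_mult: "mcoeff (mmonom c d * f) e = c * mcoeff f (e - d)"
  by transfer (rule conv_monom_left)

lemma mcoeff_plus: "mcoeff (f + g) e = mcoeff f e + mcoeff g e"
  by transfer simp

lemma mcoeff_minus: "mcoeff (f - g) e = mcoeff f e - mcoeff g e"
  unfolding minus_mlaurent_def by transfer simp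

lemma mmonom_mult: "mmonom c d * mmonom c' d' = mmonom (c * c') (d + d')"
  by (simp only: mcoeff_inject[symmetric] fun_eq_iff mcoeff_mmonom_mult)
    (auto simp: mmonom.rep_eq algebra_simps)

lemma xpow_add: "xpow i (y + z) = xpow i y * xpow i z"
  by (simp add: xpow_def mmonom_mult single_add)

lemma xpow_0: "xpow i 0 = 1"
  by (simp add: xpow_def mcoeff_inject[symmetric] fun_eq_iff mmonom.rep_eq one_mlaurent.rep_eq)

lemma one_plus_inverse: "(1 + xvar i) * inv_one_plus i = (1 :: 'a::comm_ring_1 mlaurent)"
proof -
  let ?s = "\<lambda>z. Poly_Mapping.single i (z::int)"
  have "mcoeff ((1 + xvar i) * inv_one_plus i) e = mcoeff (1 :: 'a mlaurent) e" for e
  proof -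
    have *: "mcoeff ((1 + xvar i) * inv_one_plus i) e
        = mcoeff (inv_one_plus i) e + mcoeff (inv_one_plus i :: 'a mlaurent) (e - ?s 1)"
      by (simp add: distrib_right mcoeff_plus xpow_def mcoeff_mmonom_mult)
    show ?thesis
    proof (cases "\<exists>z. e = ?s z")
      case True
      then obtain z where z: "e = ?s z" by blast
      have ex: "(\<exists>r. ?s y = ?s (int r)) \<longleftrightarrow> 0 \<le> y" for y
        by (metis lookup_single_eq nonneg_int_cases of_nat_0_le_iff)
      have e1: "e - ?s 1 = ?s (z - 1)" by (simp add: z single_diff)
      have z0: "e = 0 \<longleftrightarrow> z = 0" unfolding z by (metis lookup_single_eq lookup_zero single_zero)
      have "nat z = Suc (nat (z - 1))" if "0 < z" using that by simp
      then show ?thesis unfolding * e1 one_mlaurent.rep_eq z0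
        unfolding z inv_one_plus.rep_eq ex by auto
    next
      case False
      then have "e \<noteq> 0" by (metis single_zero)
      moreover have "e - ?s 1 \<noteq> ?s z" for z
        using False by (metis diff_add_cancel single_add)
      ultimately show ?thesis using False unfolding *
        by (auto simp: inv_one_plus.rep_eq one_mlaurent.rep_eq)
    qed
  qed
  then show ?thesis by (simp add: mcoeff_inject[symmetric] fun_eq_iff)
qed

lemma one_minus_prod_inverse:
  "(1 - xvar i * xvar j) * inv_one_minus_prod i j = (1 :: 'a::comm_ring_1 mlaurent)"
proof -
  let ?s = "\<lambda>z. Poly_Mapping.single i (z::int) + Poly_Mapping.single j z"
  have "mcoeff ((1 - xvar i * xvar j) * inv_one_minus_prod i j) e = mcoeff (1 :: 'a mlaurent) e" for e
  proof -
    have *: "mcoeff ((1 - xvar i * xvar j) * inv_one_minus_prod i j) e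
        = mcoeff (inv_one_minus_prod i j) e - mcoeff (inv_one_minus_prod i j :: 'a mlaurent) (e - ?s 1)"
      by (simp add: left_diff_distrib mcoeff_minus xpow_def mmonom_mult mcoeff_mmonom_mult)
    have add: "?s (y + z) = ?s y + ?s z" for y z by (simp add: single_add algebra_simps)
    have inj: "?s y = ?s z \<longleftrightarrow> y = z" for y z
    proof
      assume "?s y = ?s z"
      then have "Poly_Mapping.lookup (?s y) i = Poly_Mapping.lookup (?s z) i" by simp
      then show "y = z" by (auto simp: lookup_add lookup_single when_def split: if_splits)
    qed simp
    show ?thesis
    proof (cases "\<exists>z. e = ?s z")
      case True
      then obtain z where z: "e = ?s z" by blast
      have ex: "(\<exists>r. ?s y = ?s (int r)) \<longleftrightarrow> 0 \<le> y" for y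
        unfolding inj by (metis nonneg_int_cases of_nat_0_le_iff)
      have e1: "e - ?s 1 = ?s (z - 1)" unfolding z using add[of "z - 1" 1] by (simp add: algebra_simps)
      have z0: "e = 0 \<longleftrightarrow> z = 0" unfolding z using inj[of z 0] by simp
      show ?thesis unfolding * e1 one_mlaurent.rep_eq z0
        unfolding z inv_one_minus_prod.rep_eq ex by auto
    next
      case False
      then have "e \<noteq> 0" by (metis single_zero add_0)
      moreover have "e - ?s 1 \<noteq> ?s z" for z
        using False by (metis diff_add_cancel add)
      ultimately show ?thesis using False unfolding *
        by (auto simp: inv_one_minus_prod.rep_eq one_mlaurent.rep_eq)
    qed
  qed
  then show ?thesis by (simp add: mcoeff_inject[symmetric] fun_eq_iff)
qed

section \<open>Indeterminates\<close>

text \<open>The coefficient ring is \<open>\<int>[P][Q]\<close>, represented by \<^typ>\<open>int poly poly\<close>.\<close>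

definition indetP :: "int poly poly" where "indetP = [:[:0, 1:]:]"

definition indetQ :: "int poly poly" where "indetQ = [:0, 1:]"

section \<open>Magog trapezoids\<close>

text \<open>The condition \<open>i < j + k\<close> is \<open>i - j \<le> k - 1\<close> without truncated subtraction.\<close>

definition magog_index :: "nat \<Rightarrow> nat \<Rightarrow> (nat \<times> nat) set" where
  "magog_index n k = {(i, j). 1 \<le> j \<and> j \<le> i \<and> i \<le> n \<and> i < j + k}"

text \<open>Arrays are extended by 0 outside the index set, so that distinct functions are distinct arrays.\<close>

definition magog_trapezoids :: "nat \<Rightarrow> nat \<Rightarrow> nat \<Rightarrow> (nat \<Rightarrow> nat \<Rightarrow> nat) set" where
  "magog_trapezoids m n k = {a.
     (\<forall>i j. (i, j) \<notin> magog_index n k \<longrightarrow> a i j = 0) \<and>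
     (\<forall>(i, j) \<in> magog_index n k. 1 \<le> a i j \<and> a i j \<le> m + j) \<and>
     (\<forall>i j. (i, j) \<in> magog_index n k \<longrightarrow> (i + 1, j) \<in> magog_index n k \<longrightarrow> a (i + 1) j \<le> a i j) \<and>
     (\<forall>i j. (i, j) \<in> magog_index n k \<longrightarrow> (i + 1, j + 1) \<in> magog_index n k \<longrightarrow>
        a i j \<le> a (i + 1) (j + 1))}"

definition magog_minima :: "nat \<Rightarrow> nat \<Rightarrow> (nat \<Rightarrow> nat \<Rightarrow> nat) \<Rightarrow> (nat \<times> nat) set" where
  "magog_minima n k a = {(i, j) \<in> magog_index n k. i + 1 = j + k \<and> a i j = 1}"

definition magog_maxima :: "nat \<Rightarrow> nat \<Rightarrow> nat \<Rightarrow> (nat \<Rightarrow> nat \<Rightarrow> nat) \<Rightarrow> (nat \<times> nat) set" where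
  "magog_maxima m n k a = {(i, j) \<in> magog_index n k. i = j \<and> a i j = m + j}"

lemma finite_magog_index: "finite (magog_index n k)"
  by (rule finite_subset[of _ "{..n} \<times> {..n}"]) (auto simp: magog_index_def)

lemma finite_magog_trapezoids: "finite (magog_trapezoids m n k)"
proof -
  let ?F = "{f. \<forall>p. (p \<in> magog_index n k \<longrightarrow> f p \<in> {..m + n}) \<and> (p \<notin> magog_index n k \<longrightarrow> f p = 0)}"
  have "magog_trapezoids m n k \<subseteq> curry ` ?F"
  proof
    fix a assume a: "a \<in> magog_trapezoids m n k"
    have "case_prod a \<in> ?F"
      using a by (fastforce simp: magog_trapezoids_def magog_index_def)
    then show "a \<in> curry ` ?F" by (intro image_eqI[of _ _ "case_prod a"]) auto
  qed
  moreover have "finite ?F" by (intro finite_set_of_finite_funs finite_magog_index) auto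
  ultimately show ?thesis by (meson finite_imageI finite_subset)
qed

end

(*
  Read row by row, a trapezoid is a chain of interlacing rows, and the number of chains ending in a
  given row y is a determinant: column c stands for the lattice path born at (c, m + c), row a for
  the place where the a-th path is now. The interlacing sum is a product of independent sums over
  intervals, so it acts on the determinant row by row and telescopes. Once the a-th path has left
  the trapezoid, its row is frozen. With u = -x the entries are constant terms of
  (P + u/(1-u)) (1-u)^(c-i) u^(s-m-2c) and similar series, so the determinant is a constant term of a
  product of one-variable series and a Vandermonde determinant in u^2/(1-u).

  What remains is to sum over the last row. The sum is taken against a series A that is alternating
  in the last k variables. Modulo symmetrisation the generating function of weakly increasing rows
  satisfies the recursion of prod_j u_j^j/(1-u_j) prod_(i<j) 1/(1-u_i u_j), that is, of the identity
  sum_lambda s_lambda = prod 1/(1-u_j) prod 1/(1-u_i u_j).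
*)
theory Submission
  imports Defs "HOL-Library.FuncSet" "HOL-Combinatorics.Permutations"
    "Jordan_Normal_Form.Determinant"
begin

section \<open>Constant terms\<close>

text \<open>The last entry of a column is bounded below by 1 and no longer by the next row. Summing
  over it leaves a lower end that does not depend on the next row, which is why the corresponding
  row of the determinant can be frozen.

  No alternant is divided out; the identities for the last row hold only under a constant term
  against an alternating factor.

  The rows of a trapezoid are bounded, the generating function of rows is not. This does no harm:
  the determinant vanishes for rows above the bound, and the least exponent of the last variable
  kills the terms above m + n.

  The bracket of the theorem comes from the first entry of the last row, the possible minimum there.
  Entries from 2 on give the summand 1. The entry 1 gives Q times a series in the other variables,
  which is the full series with its factors in u_(n-k+1) divided out: hence 1 - u_(n-k+1) and the 1
  - u_(n-k+1) u_j. The inverses u_j^(-1) lower the start of the series from 2 to 1.\<close>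

lemma mlaurent_eqI: "(\<And>e. mcoeff f e = mcoeff g e) \<Longrightarrow> f = g"
  by (simp add: mcoeff_inject[symmetric] fun_eq_iff)

lemma const_term_add: "const_term (f + g) = const_term f + const_term g"
  by (simp add: const_term_def mcoeff_plus)

lemma const_term_diff: "const_term (f - g) = const_term f - const_term g"
  by (simp add: const_term_def mcoeff_minus)

lemma const_term_0 [simp]: "const_term 0 = 0"
  by (simp add: const_term_def zero_mlaurent.rep_eq)

lemma const_term_1 [simp]: "const_term 1 = 1"
  by (simp add: const_term_def one_mlaurent.rep_eq)

lemma const_term_uminus: "const_term (- f) = - const_term f"
  by (simp add: const_term_def uminus_mlaurent.rep_eq)

lemma const_term_sum: "const_term (sum f S) = (\<Sum>x\<in>S. const_term (f x))"
  by (induction S rule: infinite_finite_induct) (auto simp: const_term_add)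

lemma const_term_mconst_mult: "const_term (mconst c * f) = c * const_term f"
  by (simp add: const_term_def mconst_def mcoeff_mmonom_mult)

lemma mconst_1: "mconst 1 = 1"
  by (rule mlaurent_eqI) (simp add: mconst_def mmonom.rep_eq one_mlaurent.rep_eq)

lemma mconst_mult: "mconst (c * d) = mconst c * mconst d"
  by (simp add: mconst_def mmonom_mult)

lemma mconst_uminus: "mconst (- c) = - mconst c"
  by (rule mlaurent_eqI) (simp add: mconst_def mmonom.rep_eq uminus_mlaurent.rep_eq)

lemma mconst_power: "mconst (c ^ r) = mconst c ^ r"
  by (induction r) (simp_all add: mconst_1 mconst_mult)

text \<open>The power $u_i^z$ of the variable $u_i = -x_i$, in which all path counts have positive signs.\<close>

definition upow :: "nat \<Rightarrow> int \<Rightarrow> 'a::comm_ring_1 mlaurent" where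
  "upow i z = (-1) ^ nat \<bar>z\<bar> * xpow i z"

lemma upow_altdef: "upow i z = mmonom ((-1) ^ nat \<bar>z\<bar>) (Poly_Mapping.single i z)"
proof -
  have "(-1 :: 'a mlaurent) ^ nat \<bar>z\<bar> = mconst ((-1) ^ nat \<bar>z\<bar>)"
    by (simp add: mconst_power mconst_uminus mconst_1)
  then show ?thesis
    by (simp add: upow_def mconst_def xpow_def mmonom_mult)
qed

lemma minus_one_power_abs_add:
  "(-1 :: 'a::comm_ring_1) ^ nat \<bar>y + z\<bar> = (-1) ^ nat \<bar>y\<bar> * (-1) ^ nat \<bar>z\<bar>"
proof -
  have "even (nat \<bar>y + z\<bar>) \<longleftrightarrow> even (nat \<bar>y\<bar> + nat \<bar>z\<bar>)"
    by (simp add: even_nat_iff)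
  then show ?thesis by (simp add: minus_one_power_iff flip: power_add)
qed

lemma upow_add: "upow i (y + z) = upow i y * upow i z"
  by (simp add: upow_altdef mmonom_mult single_add minus_one_power_abs_add)

lemma upow_0 [simp]: "upow i 0 = 1"
  by (simp add: upow_def xpow_0)

lemma upow_1: "upow i 1 = - xvar i"
  by (simp add: upow_def)

lemma upow_power: "upow i z ^ r = upow i (int r * z)"
  by (induction r) (simp_all add: upow_add distrib_right)

lemma one_minus_upow_inverse: "(1 - upow i 1) * inv_one_plus i = 1"
  by (simp add: upow_1 one_plus_inverse)

lemma one_minus_upow_prod_inverse: "(1 - upow i 1 * upow j 1) * inv_one_minus_prod i j = 1"
  by (simp add: upow_1 one_minus_prod_inverse)

section \<open>Exchanging two variables\<close>

definition swap_expo :: "nat \<Rightarrow> nat \<Rightarrow> (nat \<Rightarrow>\<^sub>0 int) \<Rightarrow> nat \<Rightarrow>\<^sub>0 int" where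
  "swap_expo i j e = Poly_Mapping.map_key (transpose i j) e"

lemma lookup_swap_expo:
  "Poly_Mapping.lookup (swap_expo i j e) v = Poly_Mapping.lookup e (transpose i j v)"
  by (simp add: swap_expo_def map_key.rep_eq inj_transpose)

lemma swap_expo_swap_expo [simp]: "swap_expo i j (swap_expo i j e) = e"
  by (rule poly_mapping_eqI) (simp add: lookup_swap_expo)

lemma swap_expo_diff: "swap_expo i j (e - e') = swap_expo i j e - swap_expo i j e'"
  by (rule poly_mapping_eqI) (simp add: lookup_swap_expo lookup_minus)

lemma swap_expo_0 [simp]: "swap_expo i j 0 = 0"
  by (rule poly_mapping_eqI) (simp add: lookup_swap_expo)

lemma swap_expo_single:
  "swap_expo i j (Poly_Mapping.single v z) = Poly_Mapping.single (transpose i j v) z"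
  by (rule poly_mapping_eqI)
    (auto simp: lookup_swap_expo lookup_single when_def transpose_def)

lift_definition mswap :: "nat \<Rightarrow> nat \<Rightarrow> 'a::comm_ring_1 mlaurent \<Rightarrow> 'a mlaurent"
  is "\<lambda>i j f e. f (swap_expo i j e)"
proof -
  fix i j and f :: "(nat \<Rightarrow>\<^sub>0 int) \<Rightarrow> 'a"
  assume "laurent_supp f"
  then obtain V N where *: "finite V" "{e. f e \<noteq> 0} \<subseteq> expo_box V N"
    unfolding laurent_supp_def by blast
  show "laurent_supp (\<lambda>e. f (swap_expo i j e))"
  proof (rule laurent_suppI)
    show "finite (transpose i j ` V)" using * by simp
    fix e assume "f (swap_expo i j e) \<noteq> 0"
    then have e: "swap_expo i j e \<in> expo_box V N" using * by blast
    have "v \<in> transpose i j ` V" if "v \<in> Poly_Mapping.keys e" for v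
    proof -
      have "transpose i j v \<in> Poly_Mapping.keys (swap_expo i j e)"
        using that by (simp add: in_keys_iff lookup_swap_expo)
      then have "transpose i j v \<in> V" using e by (auto simp: expo_box_def)
      then show ?thesis by (metis image_eqI transpose_involutory)
    qed
    moreover have "N \<le> Poly_Mapping.lookup e v" for v
    proof -
      have "N \<le> Poly_Mapping.lookup (swap_expo i j e) (transpose i j v)"
        using e by (auto simp: expo_box_def)
      then show ?thesis by (simp add: lookup_swap_expo)
    qed
    ultimately show "e \<in> expo_box (transpose i j ` V) N" by (auto simp: expo_box_def)
  qed
qed

lemma mswap_add: "mswap i j (f + g) = mswap i j f + mswap i j g"
  by (rule mlaurent_eqI) (simp add: mswap.rep_eq mcoeff_plus)

lemma mswap_diff: "mswap i j (f - g) = mswap i j f - mswap i j g"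
  by (rule mlaurent_eqI) (simp add: mswap.rep_eq mcoeff_minus)

lemma mswap_uminus: "mswap i j (- f) = - mswap i j f"
  by (rule mlaurent_eqI) (simp add: mswap.rep_eq uminus_mlaurent.rep_eq)

lemma mswap_mmonom: "mswap i j (mmonom c d) = mmonom c (swap_expo i j d)"
  by (rule mlaurent_eqI) (auto simp: mswap.rep_eq mmonom.rep_eq)

lemma mswap_mult: "mswap i j (f * g) = mswap i j f * mswap i j g"
proof (rule mlaurent_eqI)
  fix e
  show "mcoeff (mswap i j (f * g)) e = mcoeff (mswap i j f * mswap i j g) e"
    unfolding mswap.rep_eq times_mlaurent.rep_eq conv_def
    by (rule sum.reindex_bij_witness[of _ "swap_expo i j" "swap_expo i j"])
      (auto simp: swap_expo_diff)
qed

lemma mswap_mconst [simp]: "mswap i j (mconst c) = mconst c"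
  by (simp add: mconst_def mswap_mmonom)

lemma mswap_1 [simp]: "mswap i j 1 = 1"
  by (metis mconst_1 mswap_mconst)

lemma mswap_xpow: "mswap i j (xpow v z) = xpow (transpose i j v) z"
  by (simp add: xpow_def mswap_mmonom swap_expo_single)

lemma mswap_upow: "mswap i j (upow v z) = upow (transpose i j v) z"
  by (simp add: upow_altdef mswap_mmonom swap_expo_single)

lemma mswap_power: "mswap i j (f ^ r) = mswap i j f ^ r"
  by (induction r) (simp_all add: mswap_mult)

lemma mswap_prod: "mswap i j (prod f S) = (\<Prod>x\<in>S. mswap i j (f x))"
  by (induction S rule: infinite_finite_induct) (auto simp: mswap_mult)

text \<open>The geometric series are determined by being inverses, so the effect of an exchange of
  variables on them can be found without looking at coefficients.\<close>

lemma inverse_unique_comm_ring: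
  fixes a :: "'a::comm_ring_1"
  assumes "a * b = 1" "a * c = 1"
  shows "b = c"
  using assms by (metis mult.assoc mult.commute mult.right_neutral)

lemma mswap_inv_one_plus: "mswap i j (inv_one_plus v) = inv_one_plus (transpose i j v)"
proof (rule inverse_unique_comm_ring)
  show "(1 - upow (transpose i j v) 1) * mswap i j (inv_one_plus v) = 1"
    by (metis mswap_1 mswap_diff mswap_mult mswap_upow one_minus_upow_inverse)
qed (rule one_minus_upow_inverse)

lemma mswap_inv_one_minus_prod:
  "mswap i j (inv_one_minus_prod v w) = inv_one_minus_prod (transpose i j v) (transpose i j w)"
proof (rule inverse_unique_comm_ring)
  show "(1 - upow (transpose i j v) 1 * upow (transpose i j w) 1)
      * mswap i j (inv_one_minus_prod v w) = 1"
    by (metis mswap_1 mswap_diff mswap_mult mswap_upow one_minus_upow_prod_inverse)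
qed (rule one_minus_upow_prod_inverse)

lemma inv_one_minus_prod_commute: "inv_one_minus_prod v w = inv_one_minus_prod w v"
  by (rule inverse_unique_comm_ring[OF one_minus_upow_prod_inverse])
    (simp add: one_minus_upow_prod_inverse mult.commute[of "upow v 1"])

text \<open>The exponent vector 0 is fixed by every exchange. All vanishing by antisymmetry rests on
  this.\<close>

lemma const_term_mswap [simp]: "const_term (mswap i j f) = const_term f"
  by (simp add: const_term_def mswap.rep_eq)

section \<open>Bounds on exponents\<close>

definition expo_ge :: "nat \<Rightarrow> int \<Rightarrow> 'a::comm_ring_1 mlaurent \<Rightarrow> bool" where
  "expo_ge v N f \<longleftrightarrow> (\<forall>e. mcoeff f e \<noteq> 0 \<longrightarrow> N \<le> Poly_Mapping.lookup e v)"

text \<open>Upper bounds serve Laurent polynomials, as in \<open>dead_count_eq_0\<close>; a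
  geometric series has none in its own variable.\<close>

definition expo_le :: "nat \<Rightarrow> int \<Rightarrow> 'a::comm_ring_1 mlaurent \<Rightarrow> bool" where
  "expo_le v N f \<longleftrightarrow> (\<forall>e. mcoeff f e \<noteq> 0 \<longrightarrow> Poly_Mapping.lookup e v \<le> N)"

lemma mcoeff_mult_nonzeroE:
  assumes "mcoeff (f * g) e \<noteq> 0"
  obtains a b where "mcoeff f a \<noteq> 0" "mcoeff g b \<noteq> 0" "e = a + b"
  using assms unfolding times_mlaurent.rep_eq
  by (elim conv_nonzeroE) (metis add_diff_cancel_left' diff_add_cancel add.commute)

lemma expo_ge_mult: "expo_ge v M f \<Longrightarrow> expo_ge v N g \<Longrightarrow> expo_ge v (M + N) (f * g)"
  unfolding expo_ge_def by (metis mcoeff_mult_nonzeroE lookup_add add_mono)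

lemma expo_le_mult: "expo_le v M f \<Longrightarrow> expo_le v N g \<Longrightarrow> expo_le v (M + N) (f * g)"
  unfolding expo_le_def by (metis mcoeff_mult_nonzeroE lookup_add add_mono)

lemma expo_ge_mult0: "expo_ge v N f \<Longrightarrow> expo_ge v 0 g \<Longrightarrow> expo_ge v N (f * g)"
  using expo_ge_mult[of v N f 0 g] by simp

lemma expo_ge_add: "expo_ge v N f \<Longrightarrow> expo_ge v N g \<Longrightarrow> expo_ge v N (f + g)"
  unfolding expo_ge_def by (metis mcoeff_plus add.right_neutral)

lemma expo_le_add: "expo_le v N f \<Longrightarrow> expo_le v N g \<Longrightarrow> expo_le v N (f + g)"
  unfolding expo_le_def by (metis mcoeff_plus add.right_neutral)

lemma expo_ge_diff: "expo_ge v N f \<Longrightarrow> expo_ge v N g \<Longrightarrow> expo_ge v N (f - g)"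
  unfolding expo_ge_def by (metis mcoeff_minus diff_zero)

lemma expo_le_diff: "expo_le v N f \<Longrightarrow> expo_le v N g \<Longrightarrow> expo_le v N (f - g)"
  unfolding expo_le_def by (metis mcoeff_minus diff_zero)

lemma mmonom_nonzeroD: "mcoeff (mmonom c d) e \<noteq> 0 \<Longrightarrow> e = d"
  by (auto simp: mmonom.rep_eq split: if_splits)

lemma expo_ge_mconst: "N \<le> 0 \<Longrightarrow> expo_ge v N (mconst c)"
  by (auto simp: expo_ge_def mconst_def dest!: mmonom_nonzeroD)

lemma expo_le_mconst: "0 \<le> N \<Longrightarrow> expo_le v N (mconst c)"
  by (auto simp: expo_le_def mconst_def dest!: mmonom_nonzeroD)

lemma expo_ge_1: "N \<le> 0 \<Longrightarrow> expo_ge v N 1"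
  using expo_ge_mconst[of N v 1] by (simp add: mconst_1)

lemma expo_le_1: "0 \<le> N \<Longrightarrow> expo_le v N 1"
  using expo_le_mconst[of N v 1] by (simp add: mconst_1)

lemma expo_ge_upow: "(v = w \<Longrightarrow> N \<le> z) \<Longrightarrow> (v \<noteq> w \<Longrightarrow> N \<le> 0) \<Longrightarrow> expo_ge v N (upow w z)"
  by (auto simp: expo_ge_def upow_altdef lookup_single when_def dest!: mmonom_nonzeroD)

lemma expo_le_upow: "(v = w \<Longrightarrow> z \<le> N) \<Longrightarrow> (v \<noteq> w \<Longrightarrow> 0 \<le> N) \<Longrightarrow> expo_le v N (upow w z)"
  by (auto simp: expo_le_def upow_altdef lookup_single when_def dest!: mmonom_nonzeroD)

lemma expo_ge_power: "expo_ge v 0 f \<Longrightarrow> expo_ge v 0 (f ^ r)"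
  by (induction r) (auto intro: expo_ge_1 expo_ge_mult0)

lemma expo_le_power: "expo_le v N f \<Longrightarrow> expo_le v (int r * N) (f ^ r)"
proof (induction r)
  case (Suc r)
  then show ?case using expo_le_mult[of v N f "int r * N" "f ^ r"]
    by (simp add: algebra_simps)
qed (simp add: expo_le_1)

lemma expo_ge_prod: "(\<And>x. x \<in> S \<Longrightarrow> expo_ge v 0 (f x)) \<Longrightarrow> expo_ge v 0 (prod f S)"
  by (induction S rule: infinite_finite_induct) (auto intro: expo_ge_1 expo_ge_mult0)

lemma expo_ge_inv_one_plus: "expo_ge v 0 (inv_one_plus w)"
  by (auto simp: expo_ge_def inv_one_plus.rep_eq lookup_single when_def split: if_splits)

lemma expo_ge_inv_one_minus_prod: "expo_ge v 0 (inv_one_minus_prod i j)"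
  by (auto simp: expo_ge_def inv_one_minus_prod.rep_eq lookup_single lookup_add when_def
      split: if_splits)

lemma const_term_expo_ge: "expo_ge v N f \<Longrightarrow> 0 < N \<Longrightarrow> const_term f = 0"
  by (force simp: expo_ge_def const_term_def)

lemma const_term_expo_le: "expo_le v N f \<Longrightarrow> N < 0 \<Longrightarrow> const_term f = 0"
  by (force simp: expo_le_def const_term_def)

section \<open>Products of series in disjoint sets of variables\<close>

definition in_vars :: "nat set \<Rightarrow> 'a::comm_ring_1 mlaurent \<Rightarrow> bool" where
  "in_vars V f \<longleftrightarrow> (\<forall>e. mcoeff f e \<noteq> 0 \<longrightarrow> Poly_Mapping.keys e \<subseteq> V)"

lemma in_vars_mono: "in_vars V f \<Longrightarrow> V \<subseteq> W \<Longrightarrow> in_vars W f"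
  unfolding in_vars_def by blast

lemma in_vars_mult: "in_vars V f \<Longrightarrow> in_vars V g \<Longrightarrow> in_vars V (f * g)"
  unfolding in_vars_def by (blast elim: mcoeff_mult_nonzeroE dest: subsetD[OF Poly_Mapping.keys_add])

lemma in_vars_add: "in_vars V f \<Longrightarrow> in_vars V g \<Longrightarrow> in_vars V (f + g)"
  unfolding in_vars_def by (metis mcoeff_plus add.right_neutral)

lemma in_vars_diff: "in_vars V f \<Longrightarrow> in_vars V g \<Longrightarrow> in_vars V (f - g)"
  unfolding in_vars_def by (metis mcoeff_minus diff_zero)

lemma in_vars_mconst: "in_vars V (mconst c)"
  by (auto simp: in_vars_def mconst_def dest!: mmonom_nonzeroD)

lemma in_vars_1: "in_vars V 1"
  by (metis mconst_1 in_vars_mconst)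

lemma in_vars_upow: "i \<in> V \<Longrightarrow> in_vars V (upow i z)"
  by (auto simp: in_vars_def upow_altdef dest!: mmonom_nonzeroD split: if_splits)

lemma in_vars_inv_one_plus: "i \<in> V \<Longrightarrow> in_vars V (inv_one_plus i)"
  by (auto simp: in_vars_def inv_one_plus.rep_eq split: if_splits)

lemma in_vars_power: "in_vars V f \<Longrightarrow> in_vars V (f ^ r)"
  by (induction r) (auto intro: in_vars_1 in_vars_mult)

lemma in_vars_prod: "(\<And>x. x \<in> S \<Longrightarrow> in_vars V (f x)) \<Longrightarrow> in_vars V (prod f S)"
  by (induction S rule: infinite_finite_induct) (auto intro: in_vars_1 in_vars_mult)

text \<open>A contributing pair of exponents is a and -a. Both have the same support, which lies in
  V and in W, so a = 0.\<close>

lemma const_term_mult_disjoint: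
  assumes "in_vars V f" "in_vars W g" "V \<inter> W = {}"
  shows "const_term (f * g) = const_term f * const_term g"
proof -
  have "a = 0" if "mcoeff f a \<noteq> 0" "mcoeff g (0 - a) \<noteq> 0" for a
  proof -
    have "mcoeff g (- a) \<noteq> 0" using that by simp
    then have "Poly_Mapping.keys a \<subseteq> V" "Poly_Mapping.keys (- a) \<subseteq> W"
      using that(1) assms(1,2) unfolding in_vars_def by blast+
    moreover have "Poly_Mapping.keys (- a) = Poly_Mapping.keys a"
      by (auto simp: in_keys_iff)
    ultimately show ?thesis using assms(3) by (metis inf.bounded_iff keys_eq_empty subset_empty)
  qed
  then show ?thesis
    unfolding const_term_def times_mlaurent.rep_eq
    by (subst conv_superset[of "{0}"]) auto
qed

lemma const_term_prod_disjoint: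
  assumes "finite S" "\<And>a. a \<in> S \<Longrightarrow> in_vars {a} (f a)"
  shows "const_term (\<Prod>a\<in>S. f a) = (\<Prod>a\<in>S. const_term (f a))"
  using assms
proof (induction S rule: finite_induct)
  case (insert a S)
  have "in_vars S (\<Prod>a\<in>S. f a)"
    using insert.prems by (intro in_vars_prod) (auto intro: in_vars_mono)
  then show ?case using insert by (auto simp: const_term_mult_disjoint[of "{a}" _ S])
qed simp

text \<open>In u = -x every coefficient of 1/(1-u) is 1: the signs in \<open>upow\<close> and in the
  expansion by powers of x cancel.\<close>

lemma const_term_inv_one_plus_upow:
  "const_term (inv_one_plus i * upow i z) = (if z \<le> 0 then 1 else (0 :: 'a::comm_ring_1))"
proof -
  have "const_term (inv_one_plus i * upow i z)
      = (-1) ^ nat \<bar>z\<bar> * mcoeff (inv_one_plus i :: 'a mlaurent) (Poly_Mapping.single i (- z))"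
    unfolding const_term_def upow_altdef mult.commute[of "inv_one_plus i"] mcoeff_mmonom_mult
    by (simp add: single_uminus)
  also have "\<dots> = (if z \<le> 0 then 1 else 0)"
  proof (cases "z \<le> 0")
    case True
    then have "\<exists>r. Poly_Mapping.single i (- z) = Poly_Mapping.single i (int r)"
      by (intro exI[of _ "nat (- z)"]) simp
    then show ?thesis using True unfolding inv_one_plus.rep_eq
      by (auto simp: lookup_single minus_one_power_iff)
  next
    case False
    then have "\<nexists>r. Poly_Mapping.single i (- z) = Poly_Mapping.single i (int r)"
      by (metis lookup_single_eq of_nat_0_le_iff neg_0_le_iff_le)
    then show ?thesis using False unfolding inv_one_plus.rep_eq by auto
  qed
  finally show ?thesis .
qed

lemma const_term_upow: "const_term (upow i z) = (if z = 0 then 1 else (0 :: 'a::comm_ring_1))"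
  unfolding const_term_def upow_altdef mmonom.rep_eq
  by (metis abs_0 lookup_single_eq lookup_zero nat_0 power_0 single_zero)

section \<open>Summation against alternating series\<close>

text \<open>Adjacent exchanges generate all permutations of the variables. The half-open range
  {p..<r} allows induction on p with r fixed.\<close>

definition alternating :: "nat \<Rightarrow> nat \<Rightarrow> 'a::comm_ring_1 mlaurent \<Rightarrow> bool" where
  "alternating p r A \<longleftrightarrow> (\<forall>l. p \<le> l \<and> Suc l < r \<longrightarrow> mswap l (Suc l) A = - A)"

definition symmetric_in :: "nat \<Rightarrow> nat \<Rightarrow> 'a::comm_ring_1 mlaurent \<Rightarrow> bool" where
  "symmetric_in p r G \<longleftrightarrow> (\<forall>l. p \<le> l \<and> Suc l < r \<longrightarrow> mswap l (Suc l) G = G)"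

lemma alternating_mult: "alternating p r A \<Longrightarrow> symmetric_in p r G \<Longrightarrow> alternating p r (A * G)"
  by (simp add: alternating_def symmetric_in_def mswap_mult)

lemma symmetric_in_mult: "symmetric_in p r F \<Longrightarrow> symmetric_in p r G \<Longrightarrow> symmetric_in p r (F * G)"
  by (simp add: symmetric_in_def mswap_mult)

lemma symmetric_in_diff: "symmetric_in p r F \<Longrightarrow> symmetric_in p r G \<Longrightarrow> symmetric_in p r (F - G)"
  by (simp add: symmetric_in_def mswap_diff)

lemma symmetric_in_1: "symmetric_in p r 1"
  by (simp add: symmetric_in_def)

lemma alternating_Suc: "alternating p r A \<Longrightarrow> alternating (Suc p) r A"
  by (simp add: alternating_def)

lemma symmetric_in_upow: "v < p \<Longrightarrow> symmetric_in p r (upow v z)"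
  by (auto simp: symmetric_in_def mswap_upow transpose_def)

lemma prod_adjacent_swap:
  assumes "p \<le> l" "Suc l < r"
  shows "(\<Prod>j\<in>{p..<r}. f (transpose l (Suc l) j)) = (\<Prod>j\<in>{p..<r}. f j)"
proof -
  have "transpose l (Suc l) permutes {p..<r}"
    using assms by (intro permutes_swap_id) auto
  from prod.permute[OF this, of f] show ?thesis by (simp add: comp_def)
qed

lemma symmetric_in_prod:
  assumes "\<And>l j. p \<le> l \<Longrightarrow> Suc l < r \<Longrightarrow> mswap l (Suc l) (f j) = f (transpose l (Suc l) j)"
  shows "symmetric_in p r (\<Prod>j\<in>{p..<r}. f j)"
  unfolding symmetric_in_def by (auto simp: mswap_prod assms prod_adjacent_swap)

text \<open>The exchange reverses the order of the pair (l, l + 1) only. Sorting the image of a pair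
  repairs this, and the symmetry of f makes the sorting harmless.\<close>

lemma prod_pairs_adjacent_swap:
  fixes f :: "nat \<Rightarrow> nat \<Rightarrow> 'a::comm_monoid_mult"
  assumes "p \<le> l" "Suc l < r" "\<And>i j. f i j = f j i"
  shows "(\<Prod>i\<in>{p..<r}. \<Prod>j\<in>{Suc i..<r}. f (transpose l (Suc l) i) (transpose l (Suc l) j))
    = (\<Prod>i\<in>{p..<r}. \<Prod>j\<in>{Suc i..<r}. f i j)"
proof -
  let ?t = "transpose l (Suc l)"
  let ?s = "\<lambda>(i, j). (min (?t i) (?t j), max (?t i) (?t j))"
  let ?P = "SIGMA i:{p..<r}. {Suc i..<r}"
  have "(\<Prod>(i, j)\<in>?P. f (?t i) (?t j)) = (\<Prod>(i, j)\<in>?P. f i j)"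
  proof (rule prod.reindex_bij_witness[of _ ?s ?s])
    fix x assume x: "x \<in> ?P"
    show "?s (?s x) = x" "?s (?s x) = x" using x
      by (auto simp: min_def max_def split: prod.splits if_splits)
    show "?s x \<in> ?P" "?s x \<in> ?P" using x assms(1,2)
      by (auto simp: min_def max_def transpose_def split: prod.splits if_splits)
    show "(case ?s x of (i, j) \<Rightarrow> f i j) = (case x of (i, j) \<Rightarrow> f (?t i) (?t j))"
      by (auto simp: min_def max_def assms(3) split: prod.splits)
  qed
  then show ?thesis by (simp add: prod.Sigma)
qed

lemma symmetric_in_prod_pairs:
  assumes "\<And>l i j. p \<le> l \<Longrightarrow> Suc l < r \<Longrightarrow>
      mswap l (Suc l) (f i j) = f (transpose l (Suc l) i) (transpose l (Suc l) j)"
    and "\<And>i j. f i j = f j i"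
  shows "symmetric_in p r (\<Prod>i\<in>{p..<r}. \<Prod>j\<in>{Suc i..<r}. f i j)"
  unfolding symmetric_in_def
  using prod_pairs_adjacent_swap[of p _ r f] by (auto simp: mswap_prod assms(1) assms(2)[symmetric])

text \<open>The constant term equals its own negative, hence is 0 in characteristic 0.\<close>

lemma const_term_antisymmetric:
  fixes A :: "'a::{idom, ring_char_0} mlaurent"
  assumes "mswap i j A = - A" "mswap i j G = G"
  shows "const_term (A * G) = 0"
proof -
  have "const_term (A * G) = const_term (mswap i j (A * G))" by simp
  also have "\<dots> = - const_term (A * G)"
    by (simp add: mswap_mult assms const_term_uminus)
  finally show ?thesis by (simp add: equal_neg_zero)
qed

text \<open>
  If the expansion picks $-t u_j$ but not $-t u_{j+1}$, then $u_j$ and $u_{j+1}$ get the same exponent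
  and the term vanishes. Hence only the choices of the last $s$ variables survive.
\<close>

lemma const_term_alternating_expand:
  fixes A t :: "'a::{idom, ring_char_0} mlaurent"
  assumes "p \<le> r" "alternating p r A" "symmetric_in p r t"
  shows "const_term (A * (\<Prod>j\<in>{p..<r}. upow j (int j) * (1 - t * upow j 1)))
    = (\<Sum>s\<le>r - p. const_term (A * (- t) ^ s *
        (\<Prod>j\<in>{p..<r}. upow j (if j < r - s then int j else int j + 1))))"
  using assms
proof (induction p arbitrary: A rule: inc_induct)
  case base
  then show ?case by simp
next
  case (step p)
  let ?e = "\<lambda>s j. if j < r - s then int j else int j + 1"
  define A' where "A' = A * (upow p (int p) * (1 - t * upow p 1))"
  have t: "symmetric_in (Suc p) r t" using step.prems by (simp add: symmetric_in_def)
  have split: "prod f {p..<r} = f p * prod f {Suc p..<r}" for f :: "nat \<Rightarrow> 'a mlaurent"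
    using step.hyps by (simp add: prod.atLeast_Suc_lessThan)
  have alt: "alternating (Suc p) r A'"
    unfolding A'_def using step.prems t
    by (intro alternating_mult symmetric_in_mult symmetric_in_diff symmetric_in_1
        symmetric_in_upow alternating_Suc) auto
  have "const_term (A * (\<Prod>j\<in>{p..<r}. upow j (int j) * (1 - t * upow j 1)))
      = const_term (A' * (\<Prod>j\<in>{Suc p..<r}. upow j (int j) * (1 - t * upow j 1)))"
    unfolding split A'_def by (simp add: mult.assoc)
  also have "\<dots> = (\<Sum>s\<le>r - Suc p. const_term (A' * (- t) ^ s *
      (\<Prod>j\<in>{Suc p..<r}. upow j (?e s j))))"
    by (rule step.IH[OF alt t])
  \<comment> \<open>The factor at p contributes 1 or -t u_p. In the second case its exponent p + 1
    collides with that of an unshifted u_(p+1), unless all later variables are shifted, that is, s =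
    r - Suc p. Then the shift extends to p and the number of choices becomes r - p.\<close>
  also have "\<dots> = (\<Sum>s\<le>r - Suc p. const_term (A * (- t) ^ s * (\<Prod>j\<in>{p..<r}. upow j (?e s j)))
      + (if s = r - Suc p
         then const_term (A * (- t) ^ Suc s * (\<Prod>j\<in>{p..<r}. upow j (int j + 1))) else 0))"
  proof (rule sum.cong[OF refl])
    fix s assume s: "s \<in> {..r - Suc p}"
    then have ps: "p < r - s" using step.hyps by auto
    have "A' * (- t) ^ s * (\<Prod>j\<in>{Suc p..<r}. upow j (?e s j))
        = A * (- t) ^ s * (\<Prod>j\<in>{p..<r}. upow j (?e s j))
          + A * ((- t) ^ Suc s * (upow p (int p + 1) * (\<Prod>j\<in>{Suc p..<r}. upow j (?e s j))))"
      unfolding split A'_def using ps by (simp add: upow_add algebra_simps)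
    moreover have "const_term (A * ((- t) ^ Suc s * (upow p (int p + 1) *
        (\<Prod>j\<in>{Suc p..<r}. upow j (?e s j)))))
      = (if s = r - Suc p
         then const_term (A * (- t) ^ Suc s * (\<Prod>j\<in>{p..<r}. upow j (int j + 1))) else 0)"
    proof (cases "s = r - Suc p")
      case True
      then have "(\<Prod>j\<in>{Suc p..<r}. upow j (?e s j)) = (\<Prod>j\<in>{Suc p..<r}. upow j (int j + 1))"
        using step.hyps by (intro prod.cong) auto
      then show ?thesis using True unfolding split by (simp add: mult.assoc)
    next
      case False
      then have sp: "Suc p < r - s" using s ps by auto
      have "const_term (A * ((- t) ^ Suc s * (upow p (int p + 1) *
        (\<Prod>j\<in>{Suc p..<r}. upow j (?e s j))))) = 0"
      proof (rule const_term_antisymmetric[of p "Suc p"])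
        have lr: "Suc p < r" using sp by simp
        show "mswap p (Suc p) A = - A"
          using step.prems lr by (auto simp: alternating_def)
        have "mswap p (Suc p) t = t"
          using step.prems lr by (auto simp: symmetric_in_def)
        moreover have "mswap p (Suc p) (\<Prod>j\<in>{Suc (Suc p)..<r}. upow j (?e s j))
            = (\<Prod>j\<in>{Suc (Suc p)..<r}. upow j (?e s j) :: 'a mlaurent)"
          unfolding mswap_prod by (intro prod.cong refl) (auto simp: mswap_upow transpose_def)
        moreover have "(\<Prod>j\<in>{Suc p..<r}. upow j (?e s j) :: 'a mlaurent)
            = upow (Suc p) (int p + 1) * (\<Prod>j\<in>{Suc (Suc p)..<r}. upow j (?e s j))"
          using sp lr by (simp add: prod.atLeast_Suc_lessThan add.commute)
        ultimately show "mswap p (Suc p) ((- t) ^ Suc s * (upow p (int p + 1) *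
            (\<Prod>j\<in>{Suc p..<r}. upow j (?e s j)))) = (- t) ^ Suc s * (upow p (int p + 1) *
            (\<Prod>j\<in>{Suc p..<r}. upow j (?e s j)))"
          by (simp add: mswap_mult mswap_power mswap_uminus mswap_upow mult_ac)
      qed
      then show ?thesis using False by simp
    qed
    ultimately show "const_term (A' * (- t) ^ s * (\<Prod>j\<in>{Suc p..<r}. upow j (?e s j)))
      = const_term (A * (- t) ^ s * (\<Prod>j\<in>{p..<r}. upow j (?e s j)))
      + (if s = r - Suc p
         then const_term (A * (- t) ^ Suc s * (\<Prod>j\<in>{p..<r}. upow j (int j + 1))) else 0)"
      by (simp only: const_term_add)
  qed
  also have "\<dots> = (\<Sum>s\<le>r - Suc p. const_term (A * (- t) ^ s * (\<Prod>j\<in>{p..<r}. upow j (?e s j))))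
      + const_term (A * (- t) ^ (r - p) * (\<Prod>j\<in>{p..<r}. upow j (int j + 1)))"
    using step.hyps by (simp add: sum.distrib Suc_diff_Suc)
  also have "(\<Prod>j\<in>{p..<r}. upow j (int j + 1))
      = (\<Prod>j\<in>{p..<r}. upow j (?e (r - p) j) :: 'a mlaurent)"
    using step.hyps by (intro prod.cong) auto
  also have "(\<Sum>s\<le>r - Suc p. const_term (A * (- t) ^ s * (\<Prod>j\<in>{p..<r}. upow j (?e s j))))
      + const_term (A * (- t) ^ (r - p) * (\<Prod>j\<in>{p..<r}. upow j (?e (r - p) j)))
    = (\<Sum>s\<le>r - p. const_term (A * (- t) ^ s * (\<Prod>j\<in>{p..<r}. upow j (?e s j))))"
  proof -
    have "{..r - p} = insert (r - p) {..r - Suc p}" using step.hyps by auto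
    then show ?thesis using step.hyps by (simp add: add.commute)
  qed
  finally show ?case .
qed

text \<open>For alternating A this is an alternating function of the exponents. It takes the place
  of antisymmetrised monomials: equality modulo symmetrisation becomes equality of such
  values.\<close>

definition alt_monom :: "nat \<Rightarrow> nat \<Rightarrow> 'a::comm_ring_1 mlaurent \<Rightarrow> (nat \<Rightarrow> int) \<Rightarrow> 'a" where
  "alt_monom p r A ex = const_term (A * (\<Prod>j\<in>{p..<r}. upow j (ex j)))"

lemma alt_monom_cong: "(\<And>j. p \<le> j \<Longrightarrow> j < r \<Longrightarrow> ex j = ex' j) \<Longrightarrow> alt_monom p r A ex = alt_monom p r A ex'"
  unfolding alt_monom_def by (intro arg_cong[of _ _ "\<lambda>g. const_term (A * g)"] prod.cong) auto

lemma alt_monom_swap: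
  assumes "alternating p r A" "p \<le> l" "Suc l < r"
  shows "alt_monom p r A (\<lambda>j. ex (transpose l (Suc l) j)) = - alt_monom p r A ex"
proof -
  let ?t = "transpose l (Suc l)"
  have "alt_monom p r A ex = const_term (mswap l (Suc l) (A * (\<Prod>j\<in>{p..<r}. upow j (ex j))))"
    by (simp add: alt_monom_def)
  also have "mswap l (Suc l) A = - A" using assms by (simp add: alternating_def)
  then have "mswap l (Suc l) (A * (\<Prod>j\<in>{p..<r}. upow j (ex j)))
      = - (A * (\<Prod>j\<in>{p..<r}. upow (?t j) (ex (?t (?t j)))))"
    by (simp add: mswap_mult mswap_prod mswap_upow)
  also have "(\<Prod>j\<in>{p..<r}. upow (?t j) (ex (?t (?t j)))) = (\<Prod>j\<in>{p..<r}. upow j (ex (?t j)) :: 'a mlaurent)"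
    by (rule prod_adjacent_swap[OF assms(2,3), of "\<lambda>j. upow j (ex (?t j))"])
  finally show ?thesis by (simp add: alt_monom_def const_term_uminus)
qed

lemma alt_monom_eq_0:
  fixes A :: "'a::{idom, ring_char_0} mlaurent"
  assumes "alternating p r A" "p \<le> l" "Suc l < r" "ex l = ex (Suc l)"
  shows "alt_monom p r A ex = 0"
proof -
  have "(\<lambda>j. ex (transpose l (Suc l) j)) = ex"
    using assms(4) by (auto simp: transpose_def fun_eq_iff)
  then show ?thesis using alt_monom_swap[OF assms(1-3), of ex] by (simp add: equal_neg_zero)
qed

text \<open>The exponent \<open>v\<close> of the first variable is moved \<open>d\<close> places to the right.\<close>

lemma alt_monom_move:
  assumes "alternating p r A" "p + d < r"
  shows "alt_monom p r A (\<lambda>j. if j < p + d then ex (Suc j) else if j = p + d then v else ex j)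
    = (-1) ^ d * alt_monom p r A (\<lambda>j. if j = p then v else ex j)"
  using assms(2)
proof (induction d)
  case 0
  show ?case by (auto intro!: alt_monom_cong)
next
  case (Suc d)
  let ?f = "\<lambda>d j. if j < p + d then ex (Suc j) else if j = p + d then v else ex j"
  have "?f (Suc d) = (\<lambda>j. ?f d (transpose (p + d) (Suc (p + d)) j))"
    by (auto simp: transpose_def fun_eq_iff less_Suc_eq)
  then have "alt_monom p r A (?f (Suc d)) = - alt_monom p r A (?f d)"
    using alt_monom_swap[OF assms(1), of "p + d" "?f d"] Suc.prems by simp
  then show ?case using Suc by simp
qed

text \<open>Moving v to the place i - 1 puts two equal exponents side by side.\<close>

lemma alt_monom_repeated:
  fixes A :: "'a::{idom, ring_char_0} mlaurent"
  assumes "alternating p r A" "p < i" "i < r" "ex i = v"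
  shows "alt_monom p r A (\<lambda>j. if j = p then v else ex j) = 0"
proof -
  define d where "d = i - Suc p"
  have i: "i = Suc (p + d)" using assms by (simp add: d_def)
  have "alt_monom p r A (\<lambda>j. if j < p + d then ex (Suc j) else if j = p + d then v else ex j) = 0"
    by (rule alt_monom_eq_0[OF assms(1), of "p + d"]) (use assms i in auto)
  then show ?thesis using alt_monom_move[OF assms(1), of d ex v] assms i by simp
qed

text \<open>The expansion with t = u_p shifts the last s variables by one. The exponents after p are
  then p + 1, ..., r with r - s left out, while u_p has p + s or p + s + 1. Such a term vanishes
  unless the exponent of u_p is p or the missing r - s. The former requires s = 0, the latter 2s = r
  - p or 2s + 1 = r - p; by parity exactly one of these two equations has a solution.\<close>

lemma const_term_alternating_identity:
  fixes A :: "'a::{idom, ring_char_0} mlaurent"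
  assumes "p < r" "alternating p r A"
  shows "const_term (A * ((1 - upow p 1) * upow p (int p) *
      (\<Prod>j\<in>{Suc p..<r}. upow j (int j) * (1 - upow p 1 * upow j 1))))
    = alt_monom p r A int - alt_monom p r A (\<lambda>j. int j + 1)"
proof -
  let ?e = "\<lambda>s j. if j < r - s then int j else int j + 1"
  define X where "X v s = alt_monom p r A (\<lambda>j. if j = p then v else ?e s j)" for v s
  let ?Y = "alt_monom p r A (\<lambda>j. int j + 1)"
  have split: "prod f {p..<r} = f p * prod f {Suc p..<r}" for f :: "nat \<Rightarrow> 'a mlaurent"
    using assms(1) by (simp add: prod.atLeast_Suc_lessThan)
  have X_eq: "X v s = const_term (A * (upow p v * (\<Prod>j\<in>{Suc p..<r}. upow j (?e s j))))" for v s
    unfolding X_def alt_monom_def split by (auto intro!: arg_cong[of _ _ const_term] prod.cong)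
  \<comment> \<open>The value v occurs a second time: at index v if that variable is unshifted, at
    index v - 1 if it is shifted.\<close>
  have X0: "X v s = 0" if v: "int p < v" "v \<le> int r" "v \<noteq> int (r - s)" "s < r - p" for v s
  proof (cases "v < int (r - s)")
    case True
    show ?thesis unfolding X_def
      by (rule alt_monom_repeated[OF assms(2), of "nat v" "?e s"]) (use v True in auto)
  next
    case False
    show ?thesis unfolding X_def
      by (rule alt_monom_repeated[OF assms(2), of "nat (v - 1)" "?e s"]) (use v False in auto)
  qed
  \<comment> \<open>Bringing the missing exponent r - s from the front to its sorted place takes r -
    s - 1 - p exchanges and yields p + 1, ..., r, the exponents of \<open>?Y\<close>.\<close>
  have XY: "X (int (r - s)) s = (-1) ^ (r - s - 1 - p) * ?Y" if s: "s < r - p" for s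
  proof -
    define d where "d = r - s - 1 - p"
    have d: "p + d < r" "r - s = Suc (p + d)" using s by (auto simp: d_def)
    have "?Y = alt_monom p r A (\<lambda>j. if j < p + d then ?e s (Suc j)
        else if j = p + d then int (r - s) else ?e s j)"
      by (rule alt_monom_cong) (use d in auto)
    also have "\<dots> = (-1) ^ d * X (int (r - s)) s"
      unfolding X_def by (rule alt_monom_move[OF assms(2) d(1)])
    finally have "(-1) ^ d * ?Y = X (int (r - s)) s"
      by (simp add: flip: power_add mult.assoc)
    then show ?thesis by (simp add: d_def)
  qed
  have Xp: "X (int p) 0 = alt_monom p r A int"
    unfolding X_def by (rule alt_monom_cong) auto
  have "const_term (A * ((1 - upow p 1) * upow p (int p) *
      (\<Prod>j\<in>{Suc p..<r}. upow j (int j) * (1 - upow p 1 * upow j 1))))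
    = const_term (A * ((1 - upow p 1) * upow p (int p)) *
      (\<Prod>j\<in>{Suc p..<r}. upow j (int j) * (1 - upow p 1 * upow j 1)))"
    by (simp add: mult.assoc)
  also have "\<dots> = (\<Sum>s\<le>r - Suc p. const_term (A * ((1 - upow p 1) * upow p (int p)) *
      (- upow p 1) ^ s * (\<Prod>j\<in>{Suc p..<r}. upow j (?e s j))))"
    by (rule const_term_alternating_expand)
      (use assms in \<open>auto intro!: alternating_mult[OF alternating_Suc] symmetric_in_mult
        symmetric_in_diff symmetric_in_1 symmetric_in_upow\<close>)
  also have "\<dots> = (\<Sum>s\<le>r - Suc p. (-1) ^ s * (X (int p + int s) s - X (int p + int s + 1) s))"
  proof (rule sum.cong[OF refl])
    fix s
    let ?R = "\<Prod>j\<in>{Suc p..<r}. upow j (?e s j) :: 'a mlaurent"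
    have u: "(- upow p 1 :: 'a mlaurent) ^ s = mconst ((-1) ^ s) * upow p (int s)"
    proof -
      have "(- upow p 1 :: 'a mlaurent) ^ s = (-1) ^ s * upow p 1 ^ s"
        by (rule power_minus)
      also have "(-1 :: 'a mlaurent) ^ s = mconst ((-1) ^ s)"
        by (simp add: mconst_power mconst_uminus mconst_1)
      finally show ?thesis by (simp add: upow_power)
    qed
    have "A * ((1 - upow p 1) * upow p (int p)) * (- upow p 1) ^ s * ?R
      = mconst ((-1) ^ s) * (A * (upow p (int p + int s) * ?R) - A * (upow p (int p + int s + 1) * ?R))"
      unfolding u by (simp add: upow_add algebra_simps)
    then show "const_term (A * ((1 - upow p 1) * upow p (int p)) * (- upow p 1) ^ s * ?R)
        = (-1) ^ s * (X (int p + int s) s - X (int p + int s + 1) s)"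
      unfolding X_eq by (simp only: const_term_mconst_mult const_term_diff)
  qed
  also have "\<dots> = (\<Sum>s\<le>r - Suc p. (if s = 0 then alt_monom p r A int else 0)
      - (if 2 * s = r - p then ?Y else 0) - (if 2 * s + 1 = r - p then ?Y else 0))"
  proof (rule sum.cong[OF refl])
    fix s assume "s \<in> {..r - Suc p}"
    then have s: "s < r - p" using assms(1) by auto
    have 1: "X (int p + int s) s = (if s = 0 then alt_monom p r A int
        else if 2 * s = r - p then - ((-1) ^ s) * ?Y else 0)"
    proof (cases "s = 0")
      case True
      then show ?thesis using Xp by simp
    next
      case s0: False
      show ?thesis
      proof (cases "2 * s = r - p")
        case True
        then have "int p + int s = int (r - s)" "r - s - 1 - p = s - 1" using assms(1) by auto
        then have "X (int p + int s) s = (-1) ^ (s - 1) * ?Y" using XY[OF s] by simp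
        also have "(-1 :: 'a) ^ (s - 1) = - ((-1) ^ s)" using s0 by (cases s) auto
        finally show ?thesis using s0 True by simp
      next
        case False
        then show ?thesis using s0 s X0[of "int p + int s" s] by auto
      qed
    qed
    have 2: "X (int p + int s + 1) s = (if 2 * s + 1 = r - p then (-1) ^ s * ?Y else 0)"
    proof (cases "2 * s + 1 = r - p")
      case True
      then have eq: "int p + int s + 1 = int (r - s)" "r - s - 1 - p = s" using assms(1) by auto
      show ?thesis unfolding eq(1) XY[OF s] eq(2) using True by simp
    next
      case False
      then show ?thesis using s X0[of "int p + int s + 1" s] by auto
    qed
    have sq: "(-1 :: 'a) ^ s * ((-1) ^ s * c) = c" for c
      by (simp add: flip: power_add mult.assoc)
    have "\<not> (2 * s = r - p \<and> s = 0)" using assms(1) by auto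
    then show "(-1) ^ s * (X (int p + int s) s - X (int p + int s + 1) s)
      = (if s = 0 then alt_monom p r A int else 0)
      - (if 2 * s = r - p then ?Y else 0) - (if 2 * s + 1 = r - p then ?Y else 0)"
      unfolding 1 2 by (auto simp: sq right_diff_distrib)
  qed
  also have "\<dots> = alt_monom p r A int - (\<Sum>s\<le>r - Suc p. if 2 * s = r - p then ?Y else 0)
      - (\<Sum>s\<le>r - Suc p. if 2 * s + 1 = r - p then ?Y else 0)"
    by (simp add: sum_subtractf)
  also have "\<dots> = alt_monom p r A int - ?Y"
  proof (cases "even (r - p)")
    case True
    then obtain c where c: "r - p = 2 * c" by (rule evenE)
    have "2 * s = r - p \<longleftrightarrow> s = c" "2 * s + 1 = r - p \<longleftrightarrow> False" for s
      using c by presburger+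
    moreover have "c \<le> r - Suc p" using c assms(1) by auto
    ultimately show ?thesis by simp
  next
    case False
    then obtain c where c: "r - p = 2 * c + 1" by (rule oddE)
    have "2 * s = r - p \<longleftrightarrow> False" "2 * s + 1 = r - p \<longleftrightarrow> s = c" for s
      using c by presburger+
    moreover have "c \<le> r - Suc p" using c assms(1) by auto
    ultimately show ?thesis by simp
  qed
  finally show ?thesis .
qed

section \<open>Weakly increasing rows and their generating function\<close>

definition wincr :: "nat \<Rightarrow> nat \<Rightarrow> nat \<Rightarrow> nat \<Rightarrow> (nat \<Rightarrow> nat) set" where
  "wincr p r b N = {y \<in> {p..<r} \<rightarrow>\<^sub>E {b..N}. \<forall>j. p \<le> j \<and> Suc j < r \<longrightarrow> y j \<le> y (Suc j)}"

lemma finite_wincr: "finite (wincr p r b N)"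
  unfolding wincr_def by (auto intro!: finite_PiE)

lemma wincr_ge:
  assumes "y \<in> wincr p r b N" "p \<le> j" "j < r"
  shows "y p \<le> y j"
  using assms(2,3)
proof (induction j rule: dec_induct)
  case (step i)
  then have "y i \<le> y (Suc i)" using assms(1) by (auto simp: wincr_def)
  then show ?case using step by auto
qed simp

lemma sum_wincr_first:
  assumes "p < r" "b \<le> N"
  shows "(\<Sum>y\<in>{y \<in> wincr p r b N. y p = b}. F y) = (\<Sum>z\<in>wincr (Suc p) r b N. F (z(p := b)))"
proof (rule sum.reindex_bij_witness[of _ "\<lambda>z. z(p := b)" "\<lambda>y. y(p := undefined)"])
  fix y assume y: "y \<in> {y \<in> wincr p r b N. y p = b}"
  show "y(p := undefined, p := b) = y" using y by auto
  show "y(p := undefined) \<in> wincr (Suc p) r b N"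
    using y by (auto simp: wincr_def PiE_iff extensional_def)
  show "F ((y(p := undefined))(p := b)) = F y" using y by auto
next
  fix z assume z: "z \<in> wincr (Suc p) r b N"
  then have zp: "z p = undefined" by (auto simp: wincr_def PiE_iff extensional_def)
  show "z(p := b, p := undefined) = z" using zp by auto
  have "z(p := b) \<in> {p..<r} \<rightarrow>\<^sub>E {b..N}"
    using z assms by (auto simp: wincr_def PiE_iff extensional_def)
  moreover have "(z(p := b)) j \<le> (z(p := b)) (Suc j)" if "p \<le> j" "Suc j < r" for j
    using that z by (auto simp: wincr_def PiE_iff)
  ultimately show "z(p := b) \<in> {y \<in> wincr p r b N. y p = b}" by (auto simp: wincr_def)
qed

text \<open>The first entry is the smallest, so excluding b there excludes it everywhere. Together
  with \<open>sum_wincr_first\<close> this is the recursion for sums over rows.\<close>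

lemma wincr_rest:
  assumes "p < r"
  shows "{y \<in> wincr p r b N. y p \<noteq> b} = wincr p r (Suc b) N"
proof safe
  fix y assume y: "y \<in> wincr p r b N" "y p \<noteq> b"
  then have "Suc b \<le> y p" using assms by (force simp: wincr_def PiE_iff)
  then have "Suc b \<le> y j" if "p \<le> j" "j < r" for j
    using wincr_ge[OF y(1) that] by simp
  then show "y \<in> wincr p r (Suc b) N" using y by (auto simp: wincr_def PiE_iff)
next
  fix y assume y: "y \<in> wincr p r (Suc b) N"
  then show "y \<in> wincr p r b N" by (force simp: wincr_def PiE_iff)
next
  assume "y \<in> wincr p r (Suc (y p)) N" for y :: "nat \<Rightarrow> nat"
next
  fix y assume "y \<in> wincr p r (Suc (y p)) N"
  then show False using assms by (force simp: wincr_def PiE_iff)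
qed

text \<open>Up to symmetrisation, the sum of the monomials with exponents y_j + j over all weakly
  increasing rows y with entries at least b and no upper bound.\<close>

definition free_series :: "nat \<Rightarrow> nat \<Rightarrow> nat \<Rightarrow> 'a::comm_ring_1 mlaurent" where
  "free_series p r b = (\<Prod>j\<in>{p..<r}. upow j (int b + int j) * inv_one_plus j)
    * (\<Prod>i\<in>{p..<r}. \<Prod>j\<in>{Suc i..<r}. inv_one_minus_prod i j)"

text \<open>The second factor on the left consists of the reciprocals of all factors of
  \<open>free_series\<close> that contain u_p, except for the power of u_p.\<close>

lemma free_series_first:
  assumes "p < r"
  shows "free_series p r b * ((1 - upow p 1) * (\<Prod>j\<in>{Suc p..<r}. 1 - upow p 1 * upow j 1))
    = upow p (int b + int p) * free_series (Suc p) r b"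
proof -
  have split: "prod f {p..<r} = f p * prod f {Suc p..<r}" for f :: "nat \<Rightarrow> 'a mlaurent"
    using assms by (simp add: prod.atLeast_Suc_lessThan)
  have "(\<Prod>j\<in>{Suc p..<r}. inv_one_minus_prod p j) * (\<Prod>j\<in>{Suc p..<r}. 1 - upow p 1 * upow j 1)
      = (1 :: 'a mlaurent)"
    by (subst prod.distrib[symmetric], intro prod.neutral ballI, subst mult.commute)
      (rule one_minus_upow_prod_inverse)
  moreover have "inv_one_plus p * (1 - upow p 1) = (1 :: 'a mlaurent)"
    by (subst mult.commute) (rule one_minus_upow_inverse)
  moreover have "\<And>c i v u w y x. i * v = 1 \<Longrightarrow> w * x = 1 \<Longrightarrow>
      c * i * u * (w * y) * (v * x) = c * (u * y :: 'a mlaurent)"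
    by (metis (no_types, opaque_lifting) mult.assoc mult.commute mult.right_neutral)
  ultimately show ?thesis unfolding free_series_def split by simp
qed

text \<open>Both sides satisfy the same recursion: rows starting with b leave one variable fewer,
  all others have lower bound b + 1. This gives an induction on p and, inside it, on
  \<open>Suc N - b\<close>. The bound on the exponents of A reconciles the unbounded series with
  rows bounded by N.\<close>

lemma sum_wincr_alternating:
  fixes A :: "'a::{idom, ring_char_0} mlaurent"
  assumes "p \<le> r" "alternating p r A" "\<And>v. Suc v = r \<Longrightarrow> p \<le> v \<Longrightarrow> expo_ge v (- int N - int v) A"
  shows "(\<Sum>y\<in>wincr p r b N. const_term (A * (\<Prod>j\<in>{p..<r}. upow j (int (y j) + int j))))
    = const_term (A * free_series p r b)"
  using assms
proof (induction p arbitrary: A b rule: inc_induct)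
  case base
  then show ?case by (simp add: wincr_def free_series_def)
next
  case (step p)
  let ?F = "\<lambda>y. const_term (A * (\<Prod>j\<in>{p..<r}. upow j (int (y j) + int j)))"
  have split: "prod f {p..<r} = f p * prod f {Suc p..<r}" for f :: "nat \<Rightarrow> 'a mlaurent"
    using step.hyps by (simp add: prod.atLeast_Suc_lessThan)
  show ?case
  proof (induction "Suc N - b" arbitrary: b)
    case 0
    then have b: "N < b" by simp
    then have empty: "wincr p r b N = {}" using step.hyps by (auto simp: wincr_def PiE_iff)
    \<comment> \<open>For b > N both sides are 0: in the last variable v the series has exponents at
      least b + v, more than the least exponent -N - v of A can compensate.\<close>
    define v where "v = r - 1"
    have v: "Suc v = r" "p \<le> v" using step.hyps by (auto simp: v_def)
    have "{p..<r} = insert v {p..<v}" using v by auto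
    then have "free_series p r b = upow v (int b + int v) * (inv_one_plus v
        * (\<Prod>j\<in>{p..<v}. upow j (int b + int j) * inv_one_plus j)
        * (\<Prod>i\<in>{p..<r}. \<Prod>j\<in>{Suc i..<r}. inv_one_minus_prod i j) :: 'a mlaurent)"
      unfolding free_series_def by (simp add: mult.assoc)
    moreover have "expo_ge v 0 (inv_one_plus v
        * (\<Prod>j\<in>{p..<v}. upow j (int b + int j) * inv_one_plus j)
        * (\<Prod>i\<in>{p..<r}. \<Prod>j\<in>{Suc i..<r}. inv_one_minus_prod i j) :: 'a mlaurent)"
      by (intro expo_ge_mult0 expo_ge_prod expo_ge_inv_one_plus expo_ge_inv_one_minus_prod
          expo_ge_upow) auto
    ultimately have "expo_ge v (int b + int v) (free_series p r b :: 'a mlaurent)"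
      by (auto intro!: expo_ge_mult0 expo_ge_upow)
    then have "expo_ge v ((- int N - int v) + (int b + int v)) (A * free_series p r b)"
      using step.prems v by (intro expo_ge_mult) auto
    then have "const_term (A * free_series p r b) = 0"
      using b by (elim const_term_expo_ge) auto
    then show ?case by (simp add: empty)
  next
    case (Suc d)
    then have b: "b \<le> N" "d = Suc N - Suc b" by auto
    \<comment> \<open>\<open>G\<close> collects the symmetric factors of the series and joins A, so
      that only the monomials with exponents j and j + 1 remain to be compared.\<close>
    define G :: "'a mlaurent" where "G = (\<Prod>j\<in>{p..<r}. upow j (int b) * inv_one_plus j)
        * (\<Prod>i\<in>{p..<r}. \<Prod>j\<in>{Suc i..<r}. inv_one_minus_prod i j)"
    have "symmetric_in p r G"
      unfolding G_def
      by (intro symmetric_in_mult symmetric_in_prod symmetric_in_prod_pairs)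
        (auto simp: mswap_mult mswap_upow mswap_inv_one_plus mswap_inv_one_minus_prod
          inv_one_minus_prod_commute)
    then have alt: "alternating p r (A * G)" using step.prems by (intro alternating_mult) auto
    have fs: "free_series p r (b + c) = G * (\<Prod>j\<in>{p..<r}. upow j (int j + int c))" for c
      unfolding free_series_def G_def by (simp add: prod.distrib upow_add mult_ac)
    have "const_term (A * free_series p r b) - const_term (A * free_series p r (Suc b))
        = alt_monom p r (A * G) int - alt_monom p r (A * G) (\<lambda>j. int j + 1)"
      using fs[of 0] fs[of 1] by (simp add: alt_monom_def mult.assoc)
    also have "\<dots> = const_term (A * G * ((1 - upow p 1) * upow p (int p) *
      (\<Prod>j\<in>{Suc p..<r}. upow j (int j) * (1 - upow p 1 * upow j 1))))"
      by (rule const_term_alternating_identity[OF step.hyps(2) alt, symmetric])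
    also have "\<dots> = const_term (A * (free_series p r b * ((1 - upow p 1) *
        (\<Prod>j\<in>{Suc p..<r}. 1 - upow p 1 * upow j 1))))"
      using fs[of 0] by (simp add: prod.distrib split mult_ac)
    also have "\<dots> = const_term (A * upow p (int b + int p) * free_series (Suc p) r b)"
      using step.hyps by (simp add: free_series_first mult.assoc)
    also have "\<dots> = (\<Sum>z\<in>wincr (Suc p) r b N. const_term (A * upow p (int b + int p) *
        (\<Prod>j\<in>{Suc p..<r}. upow j (int (z j) + int j))))"
    proof (rule step.IH[symmetric])
      show "alternating (Suc p) r (A * upow p (int b + int p))"
        using step.prems by (intro alternating_mult[OF alternating_Suc] symmetric_in_upow) auto
      show "expo_ge v (- int N - int v) (A * upow p (int b + int p))"
        if "Suc v = r" "Suc p \<le> v" for v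
        using step.prems(2)[of v] that by (intro expo_ge_mult0 expo_ge_upow) auto
    qed
    also have "\<dots> = (\<Sum>z\<in>wincr (Suc p) r b N. ?F (z(p := b)))"
    proof (rule sum.cong[OF refl])
      fix z
      have "(\<Prod>j\<in>{p..<r}. upow j (int ((z(p := b)) j) + int j))
        = upow p (int b + int p) * (\<Prod>j\<in>{Suc p..<r}. upow j (int (z j) + int j) :: 'a mlaurent)"
        unfolding split by (auto intro!: arg_cong2[of _ _ _ _ "(*)"] prod.cong)
      then show "const_term (A * upow p (int b + int p) *
        (\<Prod>j\<in>{Suc p..<r}. upow j (int (z j) + int j))) = ?F (z(p := b))"
        by (simp add: mult.assoc)
    qed
    also have "\<dots> = (\<Sum>y\<in>{y \<in> wincr p r b N. y p = b}. ?F y)"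
      using step.hyps b by (intro sum_wincr_first[symmetric]) auto
    finally have "const_term (A * free_series p r b)
        = (\<Sum>y\<in>{y \<in> wincr p r b N. y p = b}. ?F y) + const_term (A * free_series p r (Suc b))"
      by (simp add: algebra_simps)
    also have "const_term (A * free_series p r (Suc b)) = (\<Sum>y\<in>wincr p r (Suc b) N. ?F y)"
      using Suc.hyps(1)[OF b(2)] by simp
    also have "wincr p r (Suc b) N = {y \<in> wincr p r b N. y p \<noteq> b}"
      using step.hyps by (simp add: wincr_rest)
    also have "(\<Sum>y\<in>{y \<in> wincr p r b N. y p = b}. ?F y) + (\<Sum>y\<in>{y \<in> wincr p r b N. y p \<noteq> b}. ?F y)
        = (\<Sum>y\<in>wincr p r b N. ?F y)"
      by (subst sum.union_disjoint[symmetric]) (auto simp: finite_wincr intro!: sum.cong)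
    finally show ?case by simp
  qed
qed

section \<open>Determinants\<close>

text \<open>Indices start at 1, so that row a belongs to column a of the array and to the variable
  u_a.\<close>

definition Det :: "nat \<Rightarrow> (nat \<Rightarrow> nat \<Rightarrow> 'a::comm_ring_1) \<Rightarrow> 'a" where
  "Det n M = det (mat n n (\<lambda>(a, c). M (Suc a) (Suc c)))"

lemma Det_0 [simp]: "Det 0 M = 1"
  by (simp add: Det_def)

lemma Det_cong:
  "(\<And>a c. 1 \<le> a \<Longrightarrow> a \<le> n \<Longrightarrow> 1 \<le> c \<Longrightarrow> c \<le> n \<Longrightarrow> M a c = M' a c) \<Longrightarrow> Det n M = Det n M'"
  unfolding Det_def by (intro arg_cong[of _ _ det] eq_matI) auto

lemma Det_leibniz:
  "Det n M = (\<Sum>\<sigma> | \<sigma> permutes {0..<n}. signof \<sigma> * (\<Prod>a=1..n. M a (Suc (\<sigma> (a - 1)))))"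
proof -
  have "(\<Prod>i=0..<n. mat n n (\<lambda>(a, c). M (Suc a) (Suc c)) $$ (i, \<sigma> i))
      = (\<Prod>a=1..n. M a (Suc (\<sigma> (a - 1))))" if "\<sigma> permutes {0..<n}" for \<sigma>
  proof -
    have lt: "\<sigma> i < n" if "i < n" for i
      using permutes_in_image[OF \<open>\<sigma> permutes {0..<n}\<close>, of i] that by simp
    show ?thesis
      by (rule prod.reindex_bij_witness[of _ "\<lambda>a. a - 1" Suc]) (auto simp: lt)
  qed
  then show ?thesis
    unfolding Det_def by (subst det_def'[of _ n]) (auto intro!: sum.cong)
qed

lemma Det_transpose: "Det n (\<lambda>a c. M c a) = Det n M"
proof -
  have "mat n n (\<lambda>(a, c). M (Suc c) (Suc a)) = (mat n n (\<lambda>(a, c). M (Suc a) (Suc c)))\<^sup>T"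
    by (intro eq_matI) auto
  then show ?thesis unfolding Det_def by (simp add: det_transpose[of _ n])
qed

lemma Det_scale_rows: "Det n (\<lambda>a c. w a * M a c) = (\<Prod>a=1..n. w a) * Det n M"
  unfolding Det_leibniz by (simp add: prod.distrib sum_distrib_left mult_ac)

text \<open>Multilinearity in all rows of J at once, since \<open>PiE J B\<close> chooses the
  summation indices of different rows independently.\<close>

lemma Det_sum_rows:
  fixes f :: "nat \<Rightarrow> 'b \<Rightarrow> nat \<Rightarrow> 'a::comm_ring_1"
  assumes "J \<subseteq> {1..n}" "\<And>a. a \<in> J \<Longrightarrow> finite (B a)"
  shows "(\<Sum>y\<in>PiE J B. Det n (\<lambda>a c. if a \<in> J then f a (y a) c else g a c))
    = Det n (\<lambda>a c. if a \<in> J then (\<Sum>s\<in>B a. f a s c) else g a c)"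
proof -
  have fin: "finite J" using assms(1) finite_subset by blast
  have split: "(\<Prod>a=1..n. if a \<in> J then F a else G a) = (\<Prod>a\<in>J. F a) * (\<Prod>a\<in>{1..n} - J. G a)"
    for F G :: "nat \<Rightarrow> 'a"
  proof -
    have "(\<Prod>a=1..n. if a \<in> J then F a else G a) = (\<Prod>a\<in>J. if a \<in> J then F a else G a)
        * (\<Prod>a\<in>{1..n} - J. if a \<in> J then F a else G a)"
      using assms(1) by (subst mult.commute) (rule prod.subset_diff; simp)
    then show ?thesis by simp
  qed
  have *: "(\<Prod>a\<in>J. \<Sum>s\<in>B a. f a s (Suc (\<sigma> (a - 1))))
      = (\<Sum>y\<in>PiE J B. \<Prod>a\<in>J. f a (y a) (Suc (\<sigma> (a - 1))))" for \<sigma>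
    using fin assms(2) by (rule prod_sum_PiE)
  show ?thesis
    unfolding Det_leibniz split * sum_distrib_right sum_distrib_left by (rule sum.swap)
qed

lemma Det_last_column:
  assumes "\<And>a. 1 \<le> a \<Longrightarrow> a \<le> n \<Longrightarrow> M a (Suc n) = 0"
  shows "Det (Suc n) M = M (Suc n) (Suc n) * Det n M"
proof -
  let ?A = "mat (Suc n) (Suc n) (\<lambda>(a, c). M (Suc a) (Suc c))"
  have del: "mat_delete ?A n n = mat n n (\<lambda>(a, c). M (Suc a) (Suc c))"
    by (intro eq_matI) (auto simp: mat_delete_def)
  have "det ?A = (\<Sum>i<Suc n. ?A $$ (i, n) * cofactor ?A i n)"
    by (rule laplace_expansion_column) auto
  also have "\<dots> = ?A $$ (n, n) * cofactor ?A n n"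
    using assms by simp
  finally show ?thesis by (simp add: Det_def cofactor_def del)
qed

lemma Det_last_row:
  assumes "\<And>c. 1 \<le> c \<Longrightarrow> c \<le> n \<Longrightarrow> M (Suc n) c = 0"
  shows "Det (Suc n) M = M (Suc n) (Suc n) * Det n M"
  using Det_last_column[of n "\<lambda>a c. M c a"] assms
  by (simp add: Det_transpose[of _ M])

text \<open>Each row loses a multiple of the original next row, which is left multiplication by a
  unipotent upper bidiagonal matrix. The weights w make it possible to leave some rows
  alone.\<close>

lemma Det_bidiagonal:
  "Det n (\<lambda>a c. M a c - (if a < n then w a * M (Suc a) c else 0)) = Det n M"
proof -
  let ?A = "mat n n (\<lambda>(a, c). M (Suc a) (Suc c))"
  let ?U = "mat n n (\<lambda>(i, j). if i = j then 1 else if j = Suc i then - w (Suc i) else 0)"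
  have "mat n n (\<lambda>(a, c). M (Suc a) (Suc c) - (if Suc a < n then w (Suc a) * M (Suc (Suc a)) (Suc c) else 0))
      = ?U * ?A"
  proof (rule eq_matI)
    fix i j assume "i < dim_row (?U * ?A)" "j < dim_col (?U * ?A)"
    then have ij: "i < n" "j < n" by auto
    let ?g = "\<lambda>l. (if i = l then 1 else if l = Suc i then - w (Suc i) else 0) * M (Suc l) (Suc j)"
    have "(?U * ?A) $$ (i, j) = (\<Sum>l = 0..<n. ?g l)"
      using ij by (auto simp: scalar_prod_def intro!: sum.cong)
    also have "\<dots> = (\<Sum>l\<in>{i, Suc i} \<inter> {0..<n}. ?g l)"
      by (rule sum.mono_neutral_right) auto
    also have "{i, Suc i} \<inter> {0..<n} = (if Suc i < n then {i, Suc i} else {i})"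
      using ij by auto
    finally show "mat n n (\<lambda>(a, c). M (Suc a) (Suc c)
        - (if Suc a < n then w (Suc a) * M (Suc (Suc a)) (Suc c) else 0)) $$ (i, j)
      = (?U * ?A) $$ (i, j)"
      using ij by simp
  qed auto
  then have "Det n (\<lambda>a c. M a c - (if a < n then w a * M (Suc a) c else 0)) = det (?U * ?A)"
    unfolding Det_def by simp
  also have "\<dots> = det ?U * det ?A" by (rule det_mult) auto
  also have "det ?U = 1"
    by (subst det_upper_triangular[of _ n])
      (auto simp: upper_triangular_def prod_list_diag_prod)
  finally show ?thesis by (simp add: Det_def)
qed

lemma prod_pairs_Suc:
  fixes g :: "nat \<Rightarrow> nat \<Rightarrow> 'a::comm_monoid_mult"
  shows "(\<Prod>i=1..Suc n. \<Prod>j=i+1..Suc n. g i j)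
    = (\<Prod>i=1..n. \<Prod>j=i+1..n. g i j) * (\<Prod>i=1..n. g i (Suc n))"
proof -
  have "(\<Prod>i=1..Suc n. \<Prod>j=i+1..Suc n. g i j) = (\<Prod>i=1..n. \<Prod>j=i+1..Suc n. g i j)"
    by simp
  also have "\<dots> = (\<Prod>i=1..n. (\<Prod>j=i+1..n. g i j) * g i (Suc n))"
    by (intro prod.cong refl) (auto simp: prod.nat_ivl_Suc')
  finally show ?thesis by (simp add: prod.distrib)
qed

text \<open>In the transposed matrix, row operations with the factor z_(n+1) clear the last column
  above its bottom entry 1 and leave a factor z_c - z_(n+1) in every other column c.\<close>

lemma Det_vandermonde:
  "Det n (\<lambda>a c. z a ^ (n - c)) = (\<Prod>i=1..n. \<Prod>j=i+1..n. z i - z j)"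
proof (induction n)
  case (Suc n)
  define M where "M a c = z c ^ (Suc n - a)" for a c
  have "Det (Suc n) (\<lambda>a c. z a ^ (Suc n - c)) = Det (Suc n) M"
    unfolding M_def by (rule Det_transpose)
  also have "\<dots> = Det (Suc n) (\<lambda>a c. M a c - (if a < Suc n then z (Suc n) * M (Suc a) c else 0))"
    by (rule Det_bidiagonal[symmetric])
  also have "\<dots> = Det n (\<lambda>a c. M a c - (if a < Suc n then z (Suc n) * M (Suc a) c else 0))"
    by (subst Det_last_column) (auto simp: M_def Suc_diff_le)
  also have "\<dots> = Det n (\<lambda>a c. (z c - z (Suc n)) * z c ^ (n - a))"
    by (rule Det_cong) (auto simp: M_def Suc_diff_le algebra_simps)
  also have "\<dots> = Det n (\<lambda>a c. (z a - z (Suc n)) * z a ^ (n - c))"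
    by (rule Det_transpose)
  also have "\<dots> = (\<Prod>i=1..Suc n. \<Prod>j=i+1..Suc n. z i - z j)"
    unfolding Det_scale_rows Suc.IH prod_pairs_Suc by (rule mult.commute)
  finally show ?case .
qed simp

text \<open>Every index lies in n - 1 of the pairs.\<close>

lemma prod_pairs_mult:
  fixes f :: "nat \<Rightarrow> 'a::comm_monoid_mult"
  shows "(\<Prod>i=1..n. \<Prod>j=i+1..n. f i * f j) = (\<Prod>i=1..n. f i ^ (n - 1))"
proof (induction n)
  case (Suc n)
  have "(\<Prod>i=1..Suc n. \<Prod>j=i+1..Suc n. f i * f j)
      = (\<Prod>i=1..n. f i ^ (n - 1)) * ((\<Prod>i=1..n. f i) * f (Suc n) ^ n)"
    unfolding prod_pairs_Suc Suc.IH by (simp add: prod.distrib)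
  also have "\<dots> = (\<Prod>i=1..n. f i ^ (n - 1) * f i) * f (Suc n) ^ n"
    by (simp add: prod.distrib mult.assoc)
  also have "(\<Prod>i=1..n. f i ^ (n - 1) * f i) = (\<Prod>i=1..n. f i ^ n)"
    by (intro prod.cong refl) (auto simp flip: power_Suc2)
  finally show ?case by simp
qed simp

section \<open>Lattice paths\<close>

locale magog_weights =
  fixes P Q :: "'a::comm_ring_1" and m k :: nat
  assumes k_pos: "1 \<le> k"
begin

text \<open>Over 1 - u this is P + u + u^2 + ...: a path born at its greatest height counts P, at
  any lower height 1.\<close>

definition hP :: "nat \<Rightarrow> 'a mlaurent" where
  "hP v = mconst P * (1 - upow v 1) + upow v 1"

text \<open>Over 1 - u this is Q + u + u^2 + ...: the last entry of a column counts Q if it is 1,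
  and 1 otherwise.\<close>

definition hQ :: "nat \<Rightarrow> 'a mlaurent" where
  "hQ v = mconst Q * (1 - upow v 1) + upow v 1"

text \<open>
  \<open>path_count i c s\<close> is the weighted number of paths from the start of column \<open>c\<close> to the height \<open>s\<close> in
  row \<open>i\<close> of the array; the entries of column \<open>a\<close> are shifted up by \<open>a\<close>, so that weak inequalities
  between neighbours become strict. \<open>dead_count a c\<close> is the frozen version: column \<open>a\<close> has its last
  entry in row \<open>a + k - 1\<close>, which is weighted by \<open>Q\<close> if it equals 1. The variable with index 0 is an
  arbitrary choice.
\<close>

definition path_count :: "nat \<Rightarrow> nat \<Rightarrow> nat \<Rightarrow> 'a" where
  "path_count i c s = const_term (hP 0 * (1 - upow 0 1) ^ c * inv_one_plus 0 ^ (i + 1)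
    * upow 0 (int s - int m - 2 * int c))"

definition dead_count :: "nat \<Rightarrow> nat \<Rightarrow> 'a" where
  "dead_count a c = const_term (hP 0 * hQ 0 * (1 - upow 0 1) ^ c * inv_one_plus 0 ^ (a + k + 1)
    * upow 0 (1 + int a - int m - 2 * int c))"

lemma mswap_hP: "mswap i j (hP v) = hP (transpose i j v)"
  by (simp add: hP_def mswap_add mswap_mult mswap_diff mswap_upow)

lemma mswap_hQ: "mswap i j (hQ v) = hQ (transpose i j v)"
  by (simp add: hQ_def mswap_add mswap_mult mswap_diff mswap_upow)

text \<open>Renaming the variable lets row a of the determinant use u_a, so that the constant terms
  of different rows multiply.\<close>

lemma path_count_var:
  "path_count i c s = const_term (hP v * (1 - upow v 1) ^ c * inv_one_plus v ^ (i + 1)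
    * upow v (int s - int m - 2 * int c))"
proof -
  have "path_count i c s = const_term (mswap 0 v (hP 0 * (1 - upow 0 1) ^ c * inv_one_plus 0 ^ (i + 1)
    * upow 0 (int s - int m - 2 * int c)))"
    by (simp add: path_count_def)
  then show ?thesis
    by (simp add: mswap_mult mswap_power mswap_diff mswap_upow mswap_inv_one_plus mswap_hP)
qed

lemma dead_count_var:
  "dead_count a c = const_term (hP v * hQ v * (1 - upow v 1) ^ c * inv_one_plus v ^ (a + k + 1)
    * upow v (1 + int a - int m - 2 * int c))"
proof -
  have "dead_count a c = const_term (mswap 0 v (hP 0 * hQ 0 * (1 - upow 0 1) ^ c
    * inv_one_plus 0 ^ (a + k + 1) * upow 0 (1 + int a - int m - 2 * int c)))"
    by (simp add: dead_count_def)
  then show ?thesis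
    by (simp add: mswap_mult mswap_power mswap_diff mswap_upow mswap_inv_one_plus mswap_hP mswap_hQ)
qed

lemma expo_ge_hP: "expo_ge v 0 (hP w)"
  unfolding hP_def
  by (intro expo_ge_add expo_ge_mult0 expo_ge_mconst expo_ge_diff expo_ge_1 expo_ge_upow) auto

lemma expo_ge_one_minus_upow: "expo_ge v 0 (1 - upow w 1 :: 'a mlaurent)"
  by (intro expo_ge_diff expo_ge_1 expo_ge_upow) auto

lemma cancel_one_minus_upow:
  "(1 - upow v 1) ^ c * inv_one_plus v ^ (c + d) = (inv_one_plus v ^ d :: 'a mlaurent)"
proof -
  have "(1 - upow v 1) ^ c * inv_one_plus v ^ (c + d)
      = ((1 - upow v 1) * inv_one_plus v) ^ c * (inv_one_plus v ^ d :: 'a mlaurent)"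
    by (simp add: power_add power_mult_distrib mult.assoc)
  then show ?thesis by (simp only: one_minus_upow_inverse power_one mult_1_left)
qed

text \<open>From 1/(1-u) = 1 + u/(1-u). It expresses that height s in row i + 1 is reached from
  every height at least s in row i.\<close>

lemma path_count_Suc: "path_count (Suc i) c s = path_count (Suc i) c (Suc s) + path_count i c s"
proof -
  let ?z = "int s - int m - 2 * int c"
  have *: "inv_one_plus 0 * (1 - upow 0 1) = (1 :: 'a mlaurent)"
    by (subst mult.commute) (rule one_minus_upow_inverse)
  have u: "upow 0 (int (Suc s) - int m - 2 * int c) = upow 0 ?z * (upow 0 1 :: 'a mlaurent)"
    by (simp flip: upow_add add: algebra_simps)
  have "inv_one_plus 0 ^ (Suc i + 1) * upow 0 ?z = inv_one_plus 0 ^ (Suc i + 1) *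
      (upow 0 ?z * upow 0 1) + inv_one_plus 0 ^ (i + 1) * (inv_one_plus 0 * (1 - upow 0 1))
      * (upow 0 ?z :: 'a mlaurent)"
    by (simp add: algebra_simps)
  then show ?thesis
    unfolding path_count_def u const_term_add[symmetric] *
    by (simp add: mult.assoc distrib_left[symmetric] del: power_Suc)
qed

lemma path_count_sum:
  assumes "lo \<le> Suc hi"
  shows "(\<Sum>s\<in>{lo..hi}. path_count i c (s + a)) = path_count (Suc i) c (lo + a) - path_count (Suc i) c (Suc hi + a)"
  using assms
proof (induction hi)
  case 0
  then show ?case using path_count_Suc[of i c a] by (cases lo) auto
next
  case (Suc hi)
  show ?case
  proof (cases "lo = Suc (Suc hi)")
    case False
    then have "lo \<le> Suc hi" using Suc.prems by simp
    then show ?thesis using Suc.IH path_count_Suc[of i c "Suc hi + a"] by simp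
  qed simp
qed

lemma path_count_eq_0:
  assumes "m + 2 * c < s"
  shows "path_count i c s = 0"
proof -
  have "expo_ge 0 (0 + (int s - int m - 2 * int c)) (hP 0 * (1 - upow 0 1) ^ c
      * inv_one_plus 0 ^ (i + 1) * upow 0 (int s - int m - 2 * int c))"
    by (intro expo_ge_mult[OF _ expo_ge_upow] expo_ge_mult0 expo_ge_hP expo_ge_power
        expo_ge_one_minus_upow expo_ge_inv_one_plus) (use assms in auto)
  then show ?thesis unfolding path_count_def by (rule const_term_expo_ge) (use assms in auto)
qed

lemma path_count_diag: "path_count c c s = (if s < m + 2 * c then 1 else if s = m + 2 * c then P else 0)"
proof -
  let ?z = "int s - int m - 2 * int c"
  have "hP 0 * (1 - upow 0 1) ^ c * inv_one_plus 0 ^ (c + 1)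
      = hP 0 * inv_one_plus 0"
    by (simp only: mult.assoc cancel_one_minus_upow power_one_right)
  also have "\<dots> = mconst P * ((1 - upow 0 1) * inv_one_plus 0) + upow 0 1 * inv_one_plus 0"
    by (simp add: hP_def algebra_simps)
  also have "\<dots> = mconst P + upow 0 1 * inv_one_plus 0"
    by (simp only: one_minus_upow_inverse mult_1_right)
  finally have eq: "hP 0 * (1 - upow 0 1) ^ c * inv_one_plus 0 ^ (c + 1)
      = mconst P + upow 0 1 * inv_one_plus 0" .
  have "path_count c c s = const_term (mconst P * upow 0 ?z + inv_one_plus 0 * upow 0 (?z + 1))"
    unfolding path_count_def eq upow_add[of 0 ?z 1] by (simp add: algebra_simps)
  also have "\<dots> = P * (if ?z = 0 then 1 else 0) + (if ?z + 1 \<le> 0 then 1 else 0)"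
    by (simp only: const_term_add const_term_mconst_mult const_term_upow const_term_inv_one_plus_upow)
  finally show ?thesis by auto
qed

text \<open>In hP hQ / (1-u) all coefficients from u^2 on are 1, and the exponent read off is m + a
  + 2k - 1, which is at least 2. The value agrees with that of \<open>path_count_diag\<close> below
  the maximum, so a newly frozen row fits in with the live ones.\<close>

lemma dead_count_diag:
  assumes "1 \<le> a"
  shows "dead_count a (a + k) = 1"
proof -
  let ?z = "1 + int a - int m - 2 * int (a + k)"
  have "hP 0 * hQ 0 * (1 - upow 0 1) ^ (a + k) * inv_one_plus 0 ^ (a + k + 1)
      = hP 0 * hQ 0 * inv_one_plus 0"
    by (simp only: mult.assoc cancel_one_minus_upow power_one_right)
  also have "\<dots> = (mconst (P * Q) * (1 - upow 0 1) + mconst (P + Q) * upow 0 1)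
        * ((1 - upow 0 1) * inv_one_plus 0) + upow 0 2 * inv_one_plus 0"
  proof -
    have "upow 0 2 = (upow 0 1 * upow 0 1 :: 'a mlaurent)"
      by (simp flip: upow_add)
    moreover have "mconst (P + Q) = mconst P + mconst Q"
      by (rule mlaurent_eqI) (simp add: mconst_def mmonom.rep_eq mcoeff_plus)
    ultimately show ?thesis by (simp add: hP_def hQ_def mconst_mult algebra_simps)
  qed
  also have "\<dots> = mconst (P * Q) * (1 - upow 0 1) + mconst (P + Q) * upow 0 1
      + upow 0 2 * inv_one_plus 0"
    by (simp only: one_minus_upow_inverse mult_1_right)
  finally have "dead_count a (a + k) = const_term (mconst (P * Q) * (upow 0 ?z - upow 0 (?z + 1))
      + mconst (P + Q) * upow 0 (?z + 1) + inv_one_plus 0 * upow 0 (?z + 2))"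
    unfolding dead_count_def by (simp only: upow_add) (simp add: algebra_simps)
  also have "\<dots> = P * Q * ((if ?z = 0 then 1 else 0) - (if ?z + 1 = 0 then 1 else 0))
      + (P + Q) * (if ?z + 1 = 0 then 1 else 0) + (if ?z + 2 \<le> 0 then 1 else 0)"
    by (simp only: const_term_add const_term_diff const_term_mconst_mult const_term_upow
        const_term_inv_one_plus_upow)
  also have "\<dots> = 1" using assms k_pos by auto
  finally show ?thesis .
qed

text \<open>Column c starts after column a has ended. The power of 1 - u then absorbs the geometric
  series, and what remains is a Laurent polynomial with negative exponents only.\<close>

lemma dead_count_eq_0:
  assumes "1 \<le> a" "a + k < c"
  shows "dead_count a c = 0"
proof -
  define d where "d = c - (a + k + 1)"
  have c: "c = d + (a + k + 1)" using assms by (simp add: d_def)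
  let ?z = "1 + int a - int m - 2 * int c"
  have "(1 - upow 0 1) ^ c * inv_one_plus 0 ^ (a + k + 1)
      = (1 - upow 0 1) ^ d * ((1 - upow 0 1) ^ (a + k + 1) * inv_one_plus 0 ^ (a + k + 1 + 0))
        * (1 :: 'a mlaurent)"
    unfolding c by (simp add: power_add mult_ac)
  also have "\<dots> = (1 - upow 0 1) ^ d"
    by (simp only: cancel_one_minus_upow power_0 mult_1_right)
  finally have "dead_count a c = const_term (hP 0 * hQ 0 * (1 - upow 0 1) ^ d * upow 0 ?z)"
    unfolding dead_count_def by (simp only: mult.assoc)
  moreover have "expo_le 0 (1 + 1 + int d * 1 + ?z) (hP 0 * hQ 0 * (1 - upow 0 1) ^ d * upow 0 ?z)"
  proof (intro expo_le_mult expo_le_power)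
    have *: "expo_le 0 1 (1 - upow 0 1 :: 'a mlaurent)"
      by (intro expo_le_diff expo_le_1 expo_le_upow) auto
    have "expo_le 0 1 (mconst c * (1 - upow 0 1) + upow 0 1)" for c :: 'a
      using expo_le_mult[OF expo_le_mconst[of 0 0 c] *] by (intro expo_le_add expo_le_upow) auto
    then show "expo_le 0 1 (hP 0)" "expo_le 0 1 (hQ 0)" unfolding hP_def hQ_def by auto
    show "expo_le 0 1 (1 - upow 0 1 :: 'a mlaurent)" by (rule *)
  qed (auto intro!: expo_le_upow)
  ultimately show ?thesis using assms k_pos by (auto simp: c elim!: const_term_expo_le)
qed

text \<open>The numerator \<open>hQ\<close> splits into Q (1-u), which counts the last entry 1, and
  u, which by partial summation counts the last entries from 2 on.\<close>

lemma dead_count_eq: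
  assumes "a + k = Suc i"
  shows "dead_count a c = Q * path_count i c (1 + a) + path_count (Suc i) c (2 + a)"
proof -
  let ?z = "1 + int a - int m - 2 * int c"
  have z: "int (1 + a) - int m - 2 * int c = ?z" "int (2 + a) - int m - 2 * int c = ?z + 1" by auto
  have "hP 0 * hQ 0 * (1 - upow 0 1) ^ c * inv_one_plus 0 ^ (a + k + 1) * upow 0 ?z
      = mconst Q * (hP 0 * (1 - upow 0 1) ^ c * inv_one_plus 0 ^ (i + 1) * upow 0 ?z)
          * ((1 - upow 0 1) * inv_one_plus 0)
        + hP 0 * (1 - upow 0 1) ^ c * inv_one_plus 0 ^ (Suc i + 1) * upow 0 (?z + 1)"
    unfolding assms upow_add by (simp add: hQ_def algebra_simps)
  also have "\<dots> = mconst Q * (hP 0 * (1 - upow 0 1) ^ c * inv_one_plus 0 ^ (i + 1) * upow 0 ?z)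
        + hP 0 * (1 - upow 0 1) ^ c * inv_one_plus 0 ^ (Suc i + 1) * upow 0 (?z + 1)"
    by (simp only: one_minus_upow_inverse mult_1_right)
  finally show ?thesis
    unfolding dead_count_def path_count_def z by (simp only: const_term_add const_term_mconst_mult)
qed

section \<open>Rows of a trapezoid and the interlacing sum\<close>

definition row_index :: "nat \<Rightarrow> nat set" where
  "row_index i = {j. 1 \<le> j \<and> j \<le> i \<and> i < j + k}"

definition entry :: "nat \<Rightarrow> (nat \<Rightarrow> nat) \<Rightarrow> nat \<Rightarrow> nat \<Rightarrow> 'a" where
  "entry i y a c = (if a + k \<le> i then dead_count a c else path_count i c (y a + a))"

definition row_fillings :: "nat \<Rightarrow> nat \<Rightarrow> (nat \<Rightarrow> nat) set" where
  "row_fillings N i = {y \<in> row_index i \<rightarrow>\<^sub>E {1..N}. \<forall>j. j \<in> row_index i \<and> Suc j \<in> row_index i \<longrightarrow> y j \<le> y (Suc j)}"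

text \<open>If column j ends in row i, no entry of the next row bounds it and only positivity
  remains.\<close>

definition lower :: "nat \<Rightarrow> (nat \<Rightarrow> nat) \<Rightarrow> nat \<Rightarrow> nat" where
  "lower i y' j = (if j \<in> row_index (Suc i) then y' j else 1)"

text \<open>Weak increase of y is implied, since y j <= y' (j + 1) <= y (j + 1).\<close>

definition interlacing :: "nat \<Rightarrow> (nat \<Rightarrow> nat) \<Rightarrow> (nat \<Rightarrow> nat) set" where
  "interlacing i y' = (\<Pi>\<^sub>E j\<in>row_index i. {lower i y' j..y' (Suc j)})"

definition min_weight :: "nat \<Rightarrow> (nat \<Rightarrow> nat) \<Rightarrow> 'a" where
  "min_weight i y = (if k \<le> i \<and> y (i + 1 - k) = 1 then Q else 1)"

definition max_weight :: "nat \<Rightarrow> (nat \<Rightarrow> nat) \<Rightarrow> 'a" where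
  "max_weight i y = (if y i = m + i then P else 1)"

lemma finite_row_index: "finite (row_index i)"
  by (rule finite_subset[of _ "{..i}"]) (auto simp: row_index_def)

lemma finite_row_fillings: "finite (row_fillings N i)"
  by (rule finite_subset[of _ "row_index i \<rightarrow>\<^sub>E {1..N}"])
    (auto simp: row_fillings_def intro!: finite_PiE finite_row_index)

lemma row_index_Suc: "j \<in> row_index i \<Longrightarrow> Suc j \<in> row_index (Suc i)"
  by (auto simp: row_index_def)

lemma row_fillings_Suc_bounds:
  assumes "y' \<in> row_fillings N (Suc i)" "j \<in> row_index i"
  shows "1 \<le> lower i y' j" "lower i y' j \<le> y' (Suc j)" "y' (Suc j) \<le> N"
proof -
  have "Suc j \<in> row_index (Suc i)" using assms(2) by (rule row_index_Suc)
  then show "1 \<le> lower i y' j" "lower i y' j \<le> y' (Suc j)" "y' (Suc j) \<le> N"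
    using assms(1) by (auto simp: row_fillings_def lower_def PiE_iff)
qed

lemma sum_row:
  assumes "y' \<in> row_fillings N (Suc i)" "a \<in> row_index i"
  shows "(\<Sum>s\<in>{lower i y' a..y' (Suc a)}. (if a + k = Suc i \<and> s = 1 then Q else 1) * path_count i c (s + a))
    = entry (Suc i) y' a c - entry (Suc i) y' (Suc a) c"
proof -
  have next_entry: "entry (Suc i) y' (Suc a) c = path_count (Suc i) c (Suc (y' (Suc a)) + a)"
    using assms(2) by (auto simp: entry_def row_index_def)
  note b = row_fillings_Suc_bounds[OF assms]
  show ?thesis
  proof (cases "a + k = Suc i")
    case True
    then have l: "lower i y' a = 1" by (auto simp: lower_def row_index_def)
    define h where "h = y' (Suc a)"
    have h: "1 \<le> h" using b l by (simp add: h_def)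
    have "(\<Sum>s\<in>{1..h}. (if a + k = Suc i \<and> s = 1 then Q else 1) * path_count i c (s + a))
        = Q * path_count i c (1 + a) + (\<Sum>s\<in>{2..h}. (if a + k = Suc i \<and> s = 1 then Q else 1) * path_count i c (s + a))"
      using h True by (subst sum.atLeast_Suc_atMost) (auto simp: numeral_2_eq_2)
    also have "(\<Sum>s\<in>{2..h}. (if a + k = Suc i \<and> s = 1 then Q else 1) * path_count i c (s + a))
        = (\<Sum>s\<in>{2..h}. path_count i c (s + a))"
      by (rule sum.cong) auto
    also have "\<dots> = path_count (Suc i) c (2 + a) - path_count (Suc i) c (Suc h + a)"
      using h by (intro path_count_sum) auto
    finally show ?thesis
      unfolding l next_entry using True by (simp add: entry_def dead_count_eq h_def)
  next
    case False
    then have "a \<in> row_index (Suc i)" using assms(2) by (auto simp: row_index_def)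
    then have l: "lower i y' a = y' a" "entry (Suc i) y' a c = path_count (Suc i) c (y' a + a)"
      by (auto simp: lower_def entry_def row_index_def)
    have "(\<Sum>s\<in>{y' a..y' (Suc a)}. (if a + k = Suc i \<and> s = 1 then Q else 1) * path_count i c (s + a))
        = (\<Sum>s\<in>{y' a..y' (Suc a)}. path_count i c (s + a))"
      using False by (intro sum.cong) auto
    also have "\<dots> = path_count (Suc i) c (y' a + a) - path_count (Suc i) c (Suc (y' (Suc a)) + a)"
      using b l by (intro path_count_sum) auto
    finally show ?thesis unfolding next_entry l .
  qed
qed

text \<open>Only the row a = i + 1 - k is scaled, the one whose entry can be a minimum in row
  i.\<close>

lemma min_weight_Det:
  "min_weight i y * Det i (entry i y) = Det i (\<lambda>a c. if a \<in> row_index i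
    then (if a + k = Suc i \<and> y a = 1 then Q else 1) * path_count i c (y a + a) else dead_count a c)"
proof -
  let ?w = "\<lambda>a. if a \<in> row_index i \<and> a + k = Suc i \<and> y a = 1 then Q else 1"
  have "Det i (\<lambda>a c. if a \<in> row_index i
    then (if a + k = Suc i \<and> y a = 1 then Q else 1) * path_count i c (y a + a) else dead_count a c)
    = Det i (\<lambda>a c. ?w a * entry i y a c)"
    by (rule Det_cong) (auto simp: entry_def row_index_def)
  also have "\<dots> = (\<Prod>a=1..i. ?w a) * Det i (entry i y)"
    by (rule Det_scale_rows)
  also have "(\<Prod>a=1..i. ?w a) = (\<Prod>a=1..i. if a = i + 1 - k then (if k \<le> i \<and> y a = 1 then Q else 1) else 1)"
    using k_pos by (intro prod.cong refl) (auto simp: row_index_def)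
  also have "\<dots> = min_weight i y"
    using k_pos by (auto simp: min_weight_def prod.delta)
  finally show ?thesis ..
qed

text \<open>Let every row of the matrix for y' that is live in row i of the array lose its
  successor. The sum over y is the determinant of the result without its last row and column. If y'
  (i + 1) is maximal, the last row has become (0, ..., 0, P), otherwise the last column has become
  (0, ..., 0, 1); expanding along it gives \<open>max_weight\<close>.\<close>

lemma sum_interlacing_Det:
  assumes "y' \<in> row_fillings N (Suc i)" "y' (Suc i) \<le> m + Suc i"
  shows "max_weight (Suc i) y' * (\<Sum>y\<in>interlacing i y'. min_weight i y * Det i (entry i y))
    = Det (Suc i) (entry (Suc i) y')"
proof -
  let ?M = "entry (Suc i) y'"
  let ?w = "\<lambda>a. if a \<in> row_index i then 1 else 0 :: 'a"
  let ?B = "\<lambda>a c. ?M a c - (if a < Suc i then ?w a * ?M (Suc a) c else 0)"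
  have "(\<Sum>y\<in>interlacing i y'. min_weight i y * Det i (entry i y))
      = Det i (\<lambda>a c. if a \<in> row_index i
          then \<Sum>s\<in>{lower i y' a..y' (Suc a)}. (if a + k = Suc i \<and> s = 1 then Q else 1) * path_count i c (s + a)
          else dead_count a c)"
    unfolding min_weight_Det interlacing_def by (rule Det_sum_rows) (auto simp: row_index_def)
  also have "\<dots> = Det i ?B"
  proof (rule Det_cong)
    fix a c assume "1 \<le> a" "a \<le> i"
    then show "(if a \<in> row_index i
        then \<Sum>s\<in>{lower i y' a..y' (Suc a)}. (if a + k = Suc i \<and> s = 1 then Q else 1) * path_count i c (s + a)
        else dead_count a c) = ?B a c"
      by (cases "a \<in> row_index i") (simp only: sum_row[OF assms(1)], auto simp: entry_def row_index_def)
  qed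
  finally have sum_eq: "(\<Sum>y\<in>interlacing i y'. min_weight i y * Det i (entry i y)) = Det i ?B" .
  have last: "?B (Suc i) c = path_count (Suc i) c (y' (Suc i) + Suc i)" for c
    using k_pos by (simp add: entry_def)
  have mono: "y' j \<le> y' (Suc i)" if "j \<in> row_index (Suc i)" for j
  proof -
    have "y' j \<le> y' l" if "j \<le> l" "l \<le> Suc i" for l
      using that
    proof (induction l rule: dec_induct)
      case (step l)
      then have "l \<in> row_index (Suc i)" "Suc l \<in> row_index (Suc i)"
        using \<open>j \<in> row_index (Suc i)\<close> by (auto simp: row_index_def)
      then have "y' l \<le> y' (Suc l)" using assms(1) by (auto simp: row_fillings_def)
      then show ?case using step by auto
    qed simp
    then show ?thesis using that by (auto simp: row_index_def)
  qed
  have "Det (Suc i) ?M = Det (Suc i) ?B" by (rule Det_bidiagonal[symmetric])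
  also have "\<dots> = max_weight (Suc i) y' * Det i ?B"
  proof (cases "y' (Suc i) = m + Suc i")
    case True
    have "Det (Suc i) ?B = ?B (Suc i) (Suc i) * Det i ?B"
      by (rule Det_last_row) (unfold last, rule path_count_eq_0, use True in auto)
    also have "?B (Suc i) (Suc i) = max_weight (Suc i) y'"
      unfolding last path_count_diag using True by (simp add: max_weight_def)
    finally show ?thesis .
  next
    case False
    have live: "?M a (Suc i) = 1" if "a \<in> row_index (Suc i)" for a
    proof -
      have "y' a + a < m + 2 * Suc i"
        using mono[OF that] that False assms(2) by (auto simp: row_index_def)
      then show ?thesis using that by (auto simp: entry_def row_index_def path_count_diag)
    qed
    \<comment> \<open>The last column belongs to the path born in row i + 1. Before the subtraction
      it is 0 in rows frozen earlier and 1 in the newly frozen and the live rows, so the differences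
      vanish.\<close>
    have "Det (Suc i) ?B = ?B (Suc i) (Suc i) * Det i ?B"
    proof (rule Det_last_column)
      fix a assume a: "1 \<le> a" "a \<le> i"
      show "?B a (Suc i) = 0"
      proof (cases "a + k \<le> i")
        case True
        then show ?thesis using a dead_count_eq_0[of a "Suc i"] by (simp add: entry_def row_index_def)
      next
        case gt: False
        then have "a \<in> row_index i" using a by (auto simp: row_index_def)
        then have "?M (Suc a) (Suc i) = 1" by (intro live row_index_Suc)
        moreover have "?M a (Suc i) = 1"
        proof (cases "a + k = Suc i")
          case True
          then show ?thesis using dead_count_diag[of a] a by (simp add: entry_def)
        next
          case False
          then show ?thesis using a gt by (intro live) (auto simp: row_index_def)
        qed
        ultimately show ?thesis using a \<open>a \<in> row_index i\<close> by simp
      qed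
    qed
    also have "?B (Suc i) (Suc i) = max_weight (Suc i) y'"
      unfolding last path_count_diag using False assms(2) by (simp add: max_weight_def)
    finally show ?thesis .
  qed
  finally show ?thesis by (simp add: sum_eq)
qed

text \<open>This lets the sums run over all weakly increasing rows up to N, with no bound on the
  last entry.\<close>

lemma Det_entry_eq_0:
  assumes "m + Suc i < y' (Suc i)"
  shows "Det (Suc i) (entry (Suc i) y') = 0"
proof -
  have "entry (Suc i) y' (Suc i) c = 0" if "c \<le> Suc i" for c
    using k_pos path_count_eq_0[of c "y' (Suc i) + Suc i" "Suc i"] assms that by (simp add: entry_def)
  then show ?thesis by (subst Det_last_row) auto
qed

section \<open>Recursion over the rows of a trapezoid\<close>


lemma magog_index_iff: "(i, j) \<in> magog_index n k \<longleftrightarrow> i \<le> n \<and> j \<in> row_index i"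
  by (auto simp: magog_index_def row_index_def)

lemma row_index_0: "row_index 0 = {}"
  by (auto simp: row_index_def)

definition truncate :: "nat \<Rightarrow> (nat \<Rightarrow> nat \<Rightarrow> nat) \<Rightarrow> nat \<Rightarrow> nat \<Rightarrow> nat" where
  "truncate i a = a(Suc i := (\<lambda>_. 0))"

text \<open>Arrays are 0 outside their index set, rows are \<open>undefined\<close> outside theirs;
  \<open>extend\<close> and \<open>last_row\<close> pass between the two conventions.\<close>

definition extend :: "nat \<Rightarrow> (nat \<Rightarrow> nat \<Rightarrow> nat) \<Rightarrow> (nat \<Rightarrow> nat) \<Rightarrow> nat \<Rightarrow> nat \<Rightarrow> nat" where
  "extend i a y' = a(Suc i := (\<lambda>j. if j \<in> row_index (Suc i) then y' j else 0))"

definition last_row :: "nat \<Rightarrow> (nat \<Rightarrow> nat \<Rightarrow> nat) \<Rightarrow> nat \<Rightarrow> nat" where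
  "last_row i a = restrict (a i) (row_index i)"

text \<open>Only the last entry carries an upper bound of its own: every other y' j is at most the
  entry of column j in row i, which is at most m + j.\<close>

definition next_rows :: "nat \<Rightarrow> nat \<Rightarrow> (nat \<Rightarrow> nat) \<Rightarrow> (nat \<Rightarrow> nat) set" where
  "next_rows N i y = {y' \<in> row_fillings N (Suc i). y \<in> interlacing i y' \<and> y' (Suc i) \<le> m + Suc i}"

lemma magog_trapezoids_iff: "a \<in> magog_trapezoids m n k \<longleftrightarrow>
    (\<forall>i j. \<not> (i \<le> n \<and> j \<in> row_index i) \<longrightarrow> a i j = 0) \<and>
    (\<forall>i\<le>n. \<forall>j\<in>row_index i. 1 \<le> a i j \<and> a i j \<le> m + j) \<and>
    (\<forall>i<n. \<forall>j\<in>row_index i. j \<in> row_index (Suc i) \<longrightarrow> a (Suc i) j \<le> a i j) \<and>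
    (\<forall>i<n. \<forall>j\<in>row_index i. a i j \<le> a (Suc i) (Suc j))"
  unfolding magog_trapezoids_def Ball_def split_paired_All magog_index_iff
  using row_index_Suc by (auto simp: Suc_le_eq)

lemma extend_truncate:
  assumes "a \<in> magog_trapezoids m (Suc i) k"
  shows "extend i (truncate i a) (last_row (Suc i) a) = a"
proof (intro ext)
  fix r j
  show "extend i (truncate i a) (last_row (Suc i) a) r j = a r j"
    using assms by (auto simp: extend_def truncate_def last_row_def magog_trapezoids_iff)
qed

lemma truncate_in:
  assumes "a \<in> magog_trapezoids m (Suc i) k"
  shows "truncate i a \<in> magog_trapezoids m i k"
  using assms unfolding magog_trapezoids_iff
  by (auto simp: truncate_def le_Suc_eq less_Suc_eq)

lemma last_row_in:
  assumes a: "a \<in> magog_trapezoids m (Suc i) k" and N: "m + Suc i \<le> N"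
  shows "last_row (Suc i) a \<in> next_rows N i (last_row i (truncate i a))"
proof -
  note a' = a[unfolded magog_trapezoids_iff]
  have le: "a (Suc i) j \<le> a (Suc i) (Suc j)"
    if "j \<in> row_index (Suc i)" "Suc j \<in> row_index (Suc i)" for j
  proof -
    have "j \<in> row_index i" using that by (auto simp: row_index_def)
    then show ?thesis using a' that by (meson le_trans lessI)
  qed
  have bd: "1 \<le> a (Suc i) j \<and> a (Suc i) j \<le> m + j" if "j \<in> row_index (Suc i)" for j
    using a' that by blast
  have "last_row (Suc i) a \<in> row_fillings N (Suc i)"
    unfolding row_fillings_def last_row_def
  proof (clarsimp simp: PiE_iff le, intro conjI ballI)
    fix j assume j: "j \<in> row_index (Suc i)"
    show "Suc 0 \<le> a (Suc i) j" "a (Suc i) j \<le> N"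
      using bd[OF j] j N by (auto simp: row_index_def)
  qed
  moreover have "last_row i (truncate i a) \<in> interlacing i (last_row (Suc i) a)"
  proof -
    have "lower i (last_row (Suc i) a) j \<le> a i j \<and> a i j \<le> last_row (Suc i) a (Suc j)"
      if "j \<in> row_index i" for j
      using a' that row_index_Suc[OF that] by (auto simp: lower_def last_row_def)
    then show ?thesis
      unfolding interlacing_def by (auto simp: PiE_iff last_row_def truncate_def)
  qed
  moreover have "last_row (Suc i) a (Suc i) \<le> m + Suc i"
    using bd[of "Suc i"] k_pos by (auto simp: last_row_def row_index_def)
  ultimately show ?thesis by (simp add: next_rows_def)
qed

lemma extend_in:
  assumes a: "a \<in> magog_trapezoids m i k" and y': "y' \<in> next_rows N i (last_row i a)"
  shows "extend i a y' \<in> magog_trapezoids m (Suc i) k"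
proof -
  note a' = a[unfolded magog_trapezoids_iff]
  have y: "y' \<in> row_fillings N (Suc i)" "last_row i a \<in> interlacing i y'" "y' (Suc i) \<le> m + Suc i"
    using y' by (auto simp: next_rows_def)
  have int: "lower i y' j \<le> a i j" "a i j \<le> y' (Suc j)" if "j \<in> row_index i" for j
    using y(2) that by (auto simp: interlacing_def last_row_def PiE_iff)
  have bd: "1 \<le> y' j \<and> y' j \<le> m + j" if j: "j \<in> row_index (Suc i)" for j
  proof (cases "j = Suc i")
    case True
    then show ?thesis using y j by (auto simp: row_fillings_def PiE_iff)
  next
    case False
    then have "j \<in> row_index i" using j by (auto simp: row_index_def)
    then have "y' j \<le> a i j" "a i j \<le> m + j" using int[of j] j a' by (auto simp: lower_def)
    then show ?thesis using y j by (auto simp: row_fillings_def PiE_iff)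
  qed
  have "y' j \<le> a i j" if "j \<in> row_index i" "j \<in> row_index (Suc i)" for j
    using int(1)[OF that(1)] that by (simp add: lower_def)
  then show ?thesis
    using a' bd int row_index_Suc unfolding magog_trapezoids_iff extend_def
    by (auto simp: le_Suc_eq less_Suc_eq)
qed

lemma truncate_extend:
  "a \<in> magog_trapezoids m i k \<Longrightarrow> truncate i (extend i a y') = a"
  by (auto simp: truncate_def extend_def magog_trapezoids_iff fun_eq_iff)

lemma last_row_extend:
  "y' \<in> row_fillings N (Suc i) \<Longrightarrow> last_row (Suc i) (extend i a y') = y'"
  by (auto simp: last_row_def extend_def row_fillings_def PiE_iff extensional_def fun_eq_iff)

lemma sum_magog_Suc:
  assumes "m + Suc i \<le> N"
  shows "(\<Sum>a\<in>magog_trapezoids m (Suc i) k. G a)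
    = (\<Sum>a\<in>magog_trapezoids m i k. \<Sum>y'\<in>next_rows N i (last_row i a). G (extend i a y'))"
proof -
  have fin: "finite (next_rows N i y)" for y
    by (rule finite_subset[OF _ finite_row_fillings[of N "Suc i"]]) (auto simp: next_rows_def)
  have "(\<Sum>a\<in>magog_trapezoids m (Suc i) k. G a)
      = (\<Sum>(a, y')\<in>(SIGMA a:magog_trapezoids m i k. next_rows N i (last_row i a)). G (extend i a y'))"
  proof (rule sum.reindex_bij_witness[of _ "\<lambda>(a, y'). extend i a y'" "\<lambda>a. (truncate i a, last_row (Suc i) a)"])
    fix a assume a: "a \<in> magog_trapezoids m (Suc i) k"
    show "(case (truncate i a, last_row (Suc i) a) of (a, y') \<Rightarrow> extend i a y') = a"
      using extend_truncate[OF a] by simp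
    show "(truncate i a, last_row (Suc i) a) \<in> (SIGMA a:magog_trapezoids m i k. next_rows N i (last_row i a))"
      using truncate_in[OF a] last_row_in[OF a assms] by auto
    show "(case (truncate i a, last_row (Suc i) a) of (a, y') \<Rightarrow> G (extend i a y')) = G a"
      using extend_truncate[OF a] by simp
  next
    fix x assume "x \<in> (SIGMA a:magog_trapezoids m i k. next_rows N i (last_row i a))"
    then obtain a y' where x: "x = (a, y')" "a \<in> magog_trapezoids m i k" "y' \<in> next_rows N i (last_row i a)"
      by auto
    then show "(truncate i (case x of (a, y') \<Rightarrow> extend i a y'),
        last_row (Suc i) (case x of (a, y') \<Rightarrow> extend i a y')) = x"
      using truncate_extend[OF x(2)] last_row_extend[of y' N i a] by (auto simp: next_rows_def)
    show "(case x of (a, y') \<Rightarrow> extend i a y') \<in> magog_trapezoids m (Suc i) k"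
      using extend_in x by auto
  qed
  also have "\<dots> = (\<Sum>a\<in>magog_trapezoids m i k. \<Sum>y'\<in>next_rows N i (last_row i a). G (extend i a y'))"
    by (rule sum.Sigma[symmetric]) (auto intro: finite_magog_trapezoids fin)
  finally show ?thesis .
qed

definition weight :: "nat \<Rightarrow> (nat \<Rightarrow> nat \<Rightarrow> nat) \<Rightarrow> 'a" where
  "weight i a = P ^ card (magog_maxima m i k a) * Q ^ card (magog_minima i k a)"

lemma finite_magog_maxima: "finite (magog_maxima m i k a)"
  by (rule finite_subset[OF _ finite_magog_index[of i k]]) (auto simp: magog_maxima_def)

lemma finite_magog_minima: "finite (magog_minima i k a)"
  by (rule finite_subset[OF _ finite_magog_index[of i k]]) (auto simp: magog_minima_def)

lemma weight_extend:
  "weight (Suc i) (extend i a y') = weight i a * (max_weight (Suc i) y' * min_weight (Suc i) y')"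
proof -
  have si: "Suc i \<in> row_index (Suc i)" using k_pos by (simp add: row_index_def)
  have "magog_maxima m (Suc i) k (extend i a y') = magog_maxima m i k a
      \<union> (if y' (Suc i) = m + Suc i then {(Suc i, Suc i)} else {})"
    by (auto simp: magog_maxima_def magog_index_iff extend_def si le_Suc_eq split: if_splits)
  moreover have "(Suc i, j) \<notin> magog_maxima m i k a" for j
    by (simp add: magog_maxima_def magog_index_iff)
  ultimately have max: "P ^ card (magog_maxima m (Suc i) k (extend i a y'))
      = P ^ card (magog_maxima m i k a) * max_weight (Suc i) y'"
    by (simp add: max_weight_def finite_magog_maxima)
  have "magog_minima (Suc i) k (extend i a y') = magog_minima i k a
      \<union> (if k \<le> Suc i \<and> y' (Suc i + 1 - k) = 1 then {(Suc i, Suc i + 1 - k)} else {})"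
    using k_pos by (auto simp: magog_minima_def magog_index_iff extend_def row_index_def le_Suc_eq)
  moreover have "(Suc i, j) \<notin> magog_minima i k a" for j
    by (simp add: magog_minima_def magog_index_iff)
  ultimately have "Q ^ card (magog_minima (Suc i) k (extend i a y'))
      = Q ^ card (magog_minima i k a) * min_weight (Suc i) y'"
    by (simp add: min_weight_def finite_magog_minima)
  with max show ?thesis by (simp add: weight_def mult_ac)
qed

lemma interlacing_subset_row_fillings:
  assumes "y' \<in> row_fillings N (Suc i)"
  shows "interlacing i y' \<subseteq> row_fillings N i"
proof
  fix y assume y: "y \<in> interlacing i y'"
  then have b: "lower i y' j \<le> y j" "y j \<le> y' (Suc j)" if "j \<in> row_index i" for j
    using that by (auto simp: interlacing_def PiE_iff)
  have "y \<in> row_index i \<rightarrow>\<^sub>E {1..N}"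
    using y b row_fillings_Suc_bounds[OF assms] unfolding interlacing_def PiE_iff atLeastAtMost_iff
    by (meson order_trans)
  moreover have "y j \<le> y (Suc j)" if "j \<in> row_index i" "Suc j \<in> row_index i" for j
    using b(2)[OF that(1)] b(1)[OF that(2)] row_index_Suc[OF that(1)] by (simp add: lower_def)
  ultimately show "y \<in> row_fillings N i" by (auto simp: row_fillings_def)
qed

text \<open>The minimum in row i stays outside the determinant, because it is absorbed only when its
  column is frozen in the next step. F is arbitrary since the induction step replaces it by a sum
  over the possible next rows.\<close>

lemma sum_magog_eq_sum_Det:
  assumes "m + i \<le> N"
  shows "(\<Sum>a\<in>magog_trapezoids m i k. weight i a * F (last_row i a))
    = (\<Sum>y\<in>row_fillings N i. min_weight i y * Det i (entry i y) * F y)"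
  using assms
proof (induction i arbitrary: F)
  case 0
  have "x = (\<lambda>_ _. 0)" if "\<forall>i j. \<not> (i \<le> 0 \<and> j \<in> row_index i) \<longrightarrow> x i j = 0" for x :: "nat \<Rightarrow> nat \<Rightarrow> nat"
    using that by (intro ext) (metis empty_iff le_zero_eq row_index_0)
  then have "magog_trapezoids m 0 k = {\<lambda>_ _. 0}"
    unfolding magog_trapezoids_iff[abs_def] set_eq_iff by (auto simp: row_index_0 magog_trapezoids_iff)
  moreover have "row_fillings N 0 = {\<lambda>_. undefined}"
    by (auto simp: row_fillings_def row_index_0)
  moreover have "last_row 0 a = (\<lambda>_. undefined)" for a
    by (auto simp: last_row_def row_index_0)
  moreover have "magog_maxima m 0 k a = {}" "magog_minima 0 k a = {}" for a
    by (auto simp: magog_maxima_def magog_minima_def magog_index_def)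
  ultimately show ?case using k_pos by (simp add: weight_def min_weight_def)
next
  case (Suc i)
  let ?S = "\<lambda>y. \<Sum>y'\<in>next_rows N i y. max_weight (Suc i) y' * min_weight (Suc i) y' * F y'"
  have "(\<Sum>a\<in>magog_trapezoids m (Suc i) k. weight (Suc i) a * F (last_row (Suc i) a))
      = (\<Sum>a\<in>magog_trapezoids m i k. weight i a * ?S (last_row i a))"
    unfolding sum_magog_Suc[OF Suc.prems] sum_distrib_left
    by (intro sum.cong refl) (auto simp: weight_extend next_rows_def last_row_extend mult_ac)
  also have "\<dots> = (\<Sum>y\<in>row_fillings N i. min_weight i y * Det i (entry i y) * ?S y)"
    using Suc.prems by (intro Suc.IH) auto
  also have "\<dots> = (\<Sum>y\<in>row_fillings N i. \<Sum>y'\<in>{y' \<in> {y' \<in> row_fillings N (Suc i). y' (Suc i) \<le> m + Suc i}. y \<in> interlacing i y'}.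
      min_weight i y * Det i (entry i y) * (max_weight (Suc i) y' * min_weight (Suc i) y' * F y'))"
    unfolding sum_distrib_left by (intro sum.cong) (auto simp: next_rows_def)
  also have "\<dots> = (\<Sum>y'\<in>{y' \<in> row_fillings N (Suc i). y' (Suc i) \<le> m + Suc i}. \<Sum>y\<in>{y \<in> row_fillings N i. y \<in> interlacing i y'}.
      min_weight i y * Det i (entry i y) * (max_weight (Suc i) y' * min_weight (Suc i) y' * F y'))"
    by (rule sum.swap_restrict) (auto simp: finite_row_fillings)
  also have "\<dots> = (\<Sum>y'\<in>{y' \<in> row_fillings N (Suc i). y' (Suc i) \<le> m + Suc i}.
      min_weight (Suc i) y' * Det (Suc i) (entry (Suc i) y') * F y')"
  proof (rule sum.cong[OF refl])
    fix y' assume "y' \<in> {y' \<in> row_fillings N (Suc i). y' (Suc i) \<le> m + Suc i}"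
    then have y': "y' \<in> row_fillings N (Suc i)" "y' (Suc i) \<le> m + Suc i" by auto
    have "{y \<in> row_fillings N i. y \<in> interlacing i y'} = interlacing i y'"
      using interlacing_subset_row_fillings[OF y'(1)] by auto
    then show "(\<Sum>y\<in>{y \<in> row_fillings N i. y \<in> interlacing i y'}. min_weight i y * Det i (entry i y)
        * (max_weight (Suc i) y' * min_weight (Suc i) y' * F y'))
      = min_weight (Suc i) y' * Det (Suc i) (entry (Suc i) y') * F y'"
      unfolding sum_interlacing_Det[OF y', symmetric]
      by (simp add: sum_distrib_left sum_distrib_right mult_ac)
  qed
  also have "\<dots> = (\<Sum>y'\<in>row_fillings N (Suc i). min_weight (Suc i) y' * Det (Suc i) (entry (Suc i) y') * F y')"
  proof (rule sum.mono_neutral_left)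
    show "\<forall>y'\<in>row_fillings N (Suc i) - {y' \<in> row_fillings N (Suc i). y' (Suc i) \<le> m + Suc i}.
        min_weight (Suc i) y' * Det (Suc i) (entry (Suc i) y') * F y' = 0"
    proof
      fix y' assume "y' \<in> row_fillings N (Suc i) - {y' \<in> row_fillings N (Suc i). y' (Suc i) \<le> m + Suc i}"
      then have "Det (Suc i) (entry (Suc i) y') = 0" by (intro Det_entry_eq_0) auto
      then show "min_weight (Suc i) y' * Det (Suc i) (entry (Suc i) y') * F y' = 0" by simp
    qed
  qed (auto simp: finite_row_fillings)
  finally show ?case .
qed

end

section \<open>The determinant as a constant term\<close>

definition varprod :: "nat \<Rightarrow> 'a::comm_ring_1 mlaurent" where
  "varprod n = (\<Prod>i=1..n. \<Prod>j=i+1..n. (xvar i - xvar j) * (xvar i + xvar j + xvar i * xvar j))"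

text \<open>Each term of the Leibniz formula takes one factor from every row, and different rows use
  different variables.\<close>

lemma Det_const_term:
  assumes "\<And>a c. 1 \<le> a \<Longrightarrow> a \<le> n \<Longrightarrow> in_vars {a} (f a c)"
  shows "Det n (\<lambda>a c. const_term (f a c)) = const_term (Det n f)"
proof -
  have sgn: "const_term (signof \<sigma> * g) = signof \<sigma> * const_term g"
    for \<sigma> and g :: "'a mlaurent"
    by (simp add: sign_def const_term_uminus)
  have "const_term (\<Prod>a=1..n. f a (Suc (\<sigma> (a - 1)))) = (\<Prod>a=1..n. const_term (f a (Suc (\<sigma> (a - 1)))))"
    for \<sigma>
    by (rule const_term_prod_disjoint) (use assms in auto)
  then show ?thesis unfolding Det_leibniz by (simp add: const_term_sum sgn)
qed

text \<open>
  Vandermonde in $z_a = u_a^2/(1-u_a)$, where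
  $z_i - z_j = (x_i-x_j)(x_i+x_j+x_ix_j)/((1+x_i)(1+x_j))$.
\<close>

lemma Det_inverse_powers:
  "Det n (\<lambda>a c. ((1 - upow a 1) * upow a (-2)) ^ c)
    = (\<Prod>a=1..n. (1 - upow a 1) * upow a (- 2 * int n)) * (varprod n :: 'a::comm_ring_1 mlaurent)"
proof -
  let ?V = "\<lambda>a. 1 - upow a 1 :: 'a mlaurent"
  let ?W = "inv_one_plus :: nat \<Rightarrow> 'a mlaurent"
  define Z where "Z a = ?V a * upow a (-2)" for a
  define z where "z a = upow a 2 * ?W a" for a
  have VW: "?V a * ?W a = 1" for a by (rule one_minus_upow_inverse)
  have "Z a * z a = (?V a * ?W a) * (upow a (-2) * upow a 2)" for a
    by (simp only: Z_def z_def mult_ac)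
  then have Zz: "Z a * z a = 1" for a
    by (simp only: VW) (simp flip: upow_add)
  have pw: "Z a ^ c = Z a ^ n * z a ^ (n - c)" if "c \<le> n" for a c
  proof -
    have "Z a ^ n * z a ^ (n - c) = Z a ^ c * (Z a * z a) ^ (n - c)"
      using that by (simp add: power_mult_distrib mult.assoc[symmetric] flip: power_add)
    then show ?thesis by (simp add: Zz)
  qed
  have "Det n (\<lambda>a c. Z a ^ c) = Det n (\<lambda>a c. Z a ^ n * z a ^ (n - c))"
    by (rule Det_cong, rule pw)
  also have "\<dots> = (\<Prod>a=1..n. Z a ^ n) * (\<Prod>i=1..n. \<Prod>j=i+1..n. z i - z j)"
    by (simp only: Det_scale_rows Det_vandermonde)
  also have "(\<Prod>i=1..n. \<Prod>j=i+1..n. z i - z j) = (\<Prod>i=1..n. \<Prod>j=i+1..n. (?W i * ?W j) *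
      ((xvar i - xvar j) * (xvar i + xvar j + xvar i * xvar j)))"
  proof (intro prod.cong refl)
    fix i j
    have "upow v 2 = (xvar v * xvar v :: 'a mlaurent)" for v
      using upow_add[of v 1 1] by (simp add: upow_1)
    then have "z i - z j = xvar i * xvar i * ?W i * (?V j * ?W j) - xvar j * xvar j * ?W j * (?V i * ?W i)"
      unfolding VW z_def by simp
    also have "\<dots> = (?W i * ?W j) * ((xvar i - xvar j) * (xvar i + xvar j + xvar i * xvar j))"
      by (simp add: upow_1 algebra_simps)
    finally show "z i - z j = \<dots>" .
  qed
  also have "\<dots> = (\<Prod>i=1..n. ?W i ^ (n - 1)) * varprod n"
    by (subst prod_pairs_mult[symmetric]) (simp only: prod.distrib varprod_def)
  also have "(\<Prod>a=1..n. Z a ^ n) * ((\<Prod>i=1..n. ?W i ^ (n - 1)) * varprod n)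
      = (\<Prod>a=1..n. Z a ^ n * ?W a ^ (n - 1)) * varprod n"
    by (simp only: prod.distrib mult.assoc)
  also have "(\<Prod>a=1..n. Z a ^ n * ?W a ^ (n - 1)) = (\<Prod>a=1..n. ?V a * upow a (- 2 * int n))"
  proof (intro prod.cong refl)
    fix a assume "a \<in> {1..n}"
    then obtain d where d: "n = Suc d" by (cases n) auto
    have "Z a ^ n * ?W a ^ (n - 1) = ?V a * upow a (-2) ^ n * (?V a * ?W a) ^ d"
      by (simp add: Z_def d power_mult_distrib mult_ac)
    then show "Z a ^ n * ?W a ^ (n - 1) = ?V a * upow a (- 2 * int n)"
      by (simp only: VW power_one upow_power) (simp add: mult.commute)
  qed
  finally show ?thesis by (simp only: Z_def)
qed

text \<open>The factor of the pair (l, l + 1) changes sign; the other ordered pairs are permuted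
  among themselves.\<close>

lemma alternating_varprod:
  assumes "1 \<le> p"
  shows "alternating p (Suc n) (varprod n :: 'a::comm_ring_1 mlaurent)"
  unfolding alternating_def
proof (intro allI impI)
  fix l assume l: "p \<le> l \<and> Suc l < Suc n"
  let ?t = "transpose l (Suc l)"
  define g :: "nat \<Rightarrow> nat \<Rightarrow> 'a mlaurent"
    where "g i j = (xvar i - xvar j) * (xvar i + xvar j + xvar i * xvar j)" for i j
  let ?P = "SIGMA i:{1..n}. {i + 1..n}"
  have mem: "(l, Suc l) \<in> ?P" using l assms by auto
  have V: "varprod n = g l (Suc l) * (\<Prod>(i, j)\<in>?P - {(l, Suc l)}. g i j)"
    unfolding varprod_def g_def[symmetric]
    by (subst prod.Sigma, simp, simp, subst prod.remove[OF _ mem], auto)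
  have "mswap l (Suc l) (g i j) = g (?t i) (?t j)" for i j
    by (simp add: g_def mswap_mult mswap_add mswap_diff mswap_xpow)
  then have "mswap l (Suc l) (varprod n :: 'a mlaurent) = g (Suc l) l * (\<Prod>(i, j)\<in>?P - {(l, Suc l)}. g (?t i) (?t j))"
    unfolding V by (simp add: mswap_mult mswap_prod case_prod_beta)
  also have "(\<Prod>(i, j)\<in>?P - {(l, Suc l)}. g (?t i) (?t j)) = (\<Prod>(i, j)\<in>?P - {(l, Suc l)}. g i j)"
    by (rule prod.reindex_bij_witness[of _ "\<lambda>(i, j). (?t i, ?t j)" "\<lambda>(i, j). (?t i, ?t j)"])
      (use l assms in \<open>auto simp: transpose_def split: if_splits\<close>)
  also have "g (Suc l) l = - g l (Suc l)"
    by (simp add: g_def algebra_simps)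
  finally show "mswap l (Suc l) (varprod n :: 'a mlaurent) = - varprod n"
    by (simp only: V mult_minus_left)
qed

lemma expo_ge_varprod: "expo_ge v 0 (varprod n)"
proof -
  have "expo_ge v 0 (xvar i)" for i
    using expo_ge_mult[OF expo_ge_mconst[of 0 v "-1"] expo_ge_upow[of v i 0 1]]
    by (simp add: upow_1 mconst_uminus mconst_1)
  then show ?thesis
    unfolding varprod_def by (intro expo_ge_prod expo_ge_mult0 expo_ge_add expo_ge_diff)
qed

context magog_weights
begin

definition fixed_part :: "nat \<Rightarrow> 'a mlaurent" where
  "fixed_part n = (\<Prod>a=1..n - k. hP a * hQ a * inv_one_plus a ^ (a + k) * upow a (1 + int a - int m - 2 * int n))
    * (\<Prod>a=n - k + 1..n. hP a * inv_one_plus a ^ n * upow a (- int m - 2 * int n)) * varprod n"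

lemma prod_split_at:
  assumes "k \<le> n"
  shows "(\<Prod>a=1..n. f a) = (\<Prod>a=1..n - k. f a) * (\<Prod>a=n - k + 1..n. f a :: 'b::comm_monoid_mult)"
  using prod.ub_add_nat[of 1 "n - k" f k] assms by simp

text \<open>In row a the column index enters only as the exponent c of (1 - u_a) u_a^(-2). Once the
  rest is pulled out of the rows, a Vandermonde matrix is left.\<close>

lemma Det_entry:
  assumes "k \<le> n"
  shows "Det n (entry n y)
    = const_term (fixed_part n * (\<Prod>j=n - k + 1..n. upow j (int (y j) + int j)))"
proof -
  let ?V = "\<lambda>a. 1 - upow a 1 :: 'a mlaurent"
  let ?W = "inv_one_plus :: nat \<Rightarrow> 'a mlaurent"
  let ?Z = "\<lambda>a. ?V a * upow a (-2)"
  define f where "f a = (if a + k \<le> n then hP a * hQ a * ?W a ^ (a + k + 1) * upow a (1 + int a - int m)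
    else hP a * ?W a ^ (n + 1) * upow a (int (y a) + int a - int m))" for a
  have Z: "?Z a ^ c = ?V a ^ c * upow a (- 2 * int c)" for a c
    by (simp add: power_mult_distrib upow_power mult.commute)
  have "Det n (entry n y) = Det n (\<lambda>a c. const_term (f a * ?Z a ^ c))"
  proof (rule Det_cong)
    fix a c
    show "entry n y a c = const_term (f a * ?Z a ^ c)"
    proof (cases "a + k \<le> n")
      case True
      have "upow a (1 + int a - int m - 2 * int c) = upow a (1 + int a - int m) * (upow a (- 2 * int c) :: 'a mlaurent)"
        by (simp flip: upow_add)
      then show ?thesis
        using True by (simp add: entry_def dead_count_var[of _ _ a] f_def Z mult_ac)
    next
      case False
      have "upow a (int (y a + a) - int m - 2 * int c)
          = upow a (int (y a) + int a - int m) * (upow a (- 2 * int c) :: 'a mlaurent)"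
        by (simp flip: upow_add)
      then show ?thesis
        using False by (simp add: entry_def path_count_var[of _ _ _ a] f_def Z mult_ac)
    qed
  qed
  also have "\<dots> = const_term (Det n (\<lambda>a c. f a * ?Z a ^ c))"
    by (rule Det_const_term)
      (auto simp: f_def hP_def hQ_def intro!: in_vars_mult in_vars_add in_vars_diff in_vars_power
        in_vars_mconst in_vars_upow in_vars_inv_one_plus in_vars_1)
  also have "Det n (\<lambda>a c. f a * ?Z a ^ c)
      = (\<Prod>a=1..n. f a * (?V a * upow a (- 2 * int n))) * varprod n"
    by (simp only: Det_scale_rows Det_inverse_powers prod.distrib mult.assoc)
  also have "(\<Prod>a=1..n. f a * (?V a * upow a (- 2 * int n)))
      = (\<Prod>a=1..n - k. hP a * hQ a * ?W a ^ (a + k) * upow a (1 + int a - int m - 2 * int n))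
        * (\<Prod>a=n - k + 1..n. hP a * ?W a ^ n * upow a (- int m - 2 * int n) * upow a (int (y a) + int a))"
    unfolding prod_split_at[OF assms]
  proof (rule arg_cong2[of _ _ _ _ "(*)"]; rule prod.cong[OF refl])
    fix a assume "a \<in> {1..n - k}"
    then have a: "a + k \<le> n" using assms by auto
    have "f a * (?V a * upow a (- 2 * int n)) = hP a * hQ a * ?W a ^ (a + k) * (?V a * ?W a)
        * (upow a (1 + int a - int m) * upow a (- 2 * int n))"
      using a by (simp add: f_def mult_ac)
    then show "f a * (?V a * upow a (- 2 * int n))
        = hP a * hQ a * ?W a ^ (a + k) * upow a (1 + int a - int m - 2 * int n)"
      by (simp only: one_minus_upow_inverse) (simp flip: upow_add)
  next
    fix a assume "a \<in> {n - k + 1..n}"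
    then have a: "\<not> a + k \<le> n" using assms by auto
    have "f a * (?V a * upow a (- 2 * int n)) = hP a * ?W a ^ n * (?V a * ?W a)
        * (upow a (int (y a) + int a - int m) * upow a (- 2 * int n))"
      using a by (simp add: f_def mult_ac)
    moreover have "upow a (int (y a) + int a - int m) * upow a (- 2 * int n)
        = upow a (- int m - 2 * int n) * (upow a (int (y a) + int a) :: 'a mlaurent)"
      by (simp add: algebra_simps flip: upow_add)
    ultimately show "f a * (?V a * upow a (- 2 * int n))
        = hP a * ?W a ^ n * upow a (- int m - 2 * int n) * upow a (int (y a) + int a)"
      by (simp only: one_minus_upow_inverse) (simp add: mult.assoc)
  qed
  finally show ?thesis by (simp add: fixed_part_def prod.distrib mult_ac)
qed

text \<open>For a > n - k the factors have the same form in each variable. For smaller a their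
  exponents involve a, but those variables are not exchanged.\<close>

lemma alternating_fixed_part:
  assumes "k \<le> n"
  shows "alternating (n - k + 1) (Suc n) (fixed_part n)"
proof -
  let ?p = "n - k + 1"
  have "symmetric_in ?p (Suc n) (\<Prod>a\<in>{?p..<Suc n}. hP a * inv_one_plus a ^ n * upow a (- int m - 2 * int n))"
    by (rule symmetric_in_prod)
      (simp add: mswap_mult mswap_power mswap_inv_one_plus mswap_upow mswap_hP)
  moreover have "symmetric_in ?p (Suc n)
      (\<Prod>a=1..n - k. hP a * hQ a * inv_one_plus a ^ (a + k) * upow a (1 + int a - int m - 2 * int n))"
    unfolding symmetric_in_def mswap_prod
    by (intro allI impI prod.cong refl)
      (auto simp: mswap_mult mswap_power mswap_inv_one_plus mswap_upow mswap_hP mswap_hQ transpose_def)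
  ultimately have "alternating ?p (Suc n) (varprod n * (
      (\<Prod>a=1..n - k. hP a * hQ a * inv_one_plus a ^ (a + k) * upow a (1 + int a - int m - 2 * int n))
      * (\<Prod>a\<in>{?p..<Suc n}. hP a * inv_one_plus a ^ n * upow a (- int m - 2 * int n))))"
    by (intro alternating_mult symmetric_in_mult alternating_varprod) auto
  then show ?thesis
    by (simp add: fixed_part_def mult_ac atLeastLessThanSuc_atLeastAtMost)
qed

text \<open>The least exponent -m - 2n is -(m + n) - n, so the choice N = m + n satisfies both
  \<open>sum_wincr_alternating\<close> and the bound m + n on the entries.\<close>

lemma expo_ge_fixed_part:
  assumes "k \<le> n" "1 \<le> n"
  shows "expo_ge n (- int (m + n) - int n) (fixed_part n)"
proof -
  let ?p = "n - k + 1"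
  have hQ: "expo_ge v 0 (hQ w)" for v w
    unfolding hQ_def
    by (intro expo_ge_add expo_ge_mult0 expo_ge_mconst expo_ge_diff expo_ge_1 expo_ge_upow) auto
  have p: "?p \<le> n" using assms k_pos by auto
  have 1: "expo_ge n 0 (\<Prod>a=1..n - k. hP a * hQ a * inv_one_plus a ^ (a + k) * upow a (1 + int a - int m - 2 * int n))"
    using p by (intro expo_ge_prod expo_ge_mult0 expo_ge_hP hQ expo_ge_power expo_ge_inv_one_plus
        expo_ge_upow) auto
  have 2: "expo_ge n 0 (\<Prod>a\<in>{?p..<n}. hP a * inv_one_plus a ^ n * upow a (- int m - 2 * int n))"
    by (intro expo_ge_prod expo_ge_mult0 expo_ge_hP expo_ge_power expo_ge_inv_one_plus
        expo_ge_upow) auto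
  have 3: "expo_ge n (- int (m + n) - int n) (upow n (- int m - 2 * int n) :: 'a mlaurent)"
    by (rule expo_ge_upow) auto
  have "{?p..n} = insert n {?p..<n}" using p by auto
  then have "fixed_part n = upow n (- int m - 2 * int n) * ((hP n * inv_one_plus n ^ n)
    * (\<Prod>a=1..n - k. hP a * hQ a * inv_one_plus a ^ (a + k) * upow a (1 + int a - int m - 2 * int n))
    * (\<Prod>a\<in>{?p..<n}. hP a * inv_one_plus a ^ n * upow a (- int m - 2 * int n)) * varprod n)"
    unfolding fixed_part_def by (simp add: mult_ac)
  then show ?thesis
    by (simp only:) (intro expo_ge_mult0 1 2 3 expo_ge_hP expo_ge_power expo_ge_inv_one_plus expo_ge_varprod)
qed

end

section \<open>Summation over the last row\<close>

lemma magog_generating_function: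
  fixes P Q :: "'a::{idom, ring_char_0}"
  assumes "1 \<le> k" "k \<le> n" and p: "p = n - k + 1"
  shows "(\<Sum>a\<in>magog_trapezoids m n k. P ^ card (magog_maxima m n k a) * Q ^ card (magog_minima n k a))
    = const_term (magog_weights.fixed_part P Q m k n * free_series p (Suc n) 2
      * (mconst Q * (\<Prod>j=p..n. upow j (-1)) * (1 - upow p 1)
          * (\<Prod>j=p + 1..n. 1 - upow p 1 * upow j 1) + 1))"
proof -
  interpret magog_weights P Q m k by unfold_locales fact
  let ?r = "Suc n" and ?N = "m + n"
  let ?A = "fixed_part n"
  have pr: "p < ?r" "1 \<le> p" using assms by auto
  define T where "T y = const_term (?A * (\<Prod>j\<in>{p..<?r}. upow j (int (y j) + int j)))" for y
  have alt: "alternating p ?r ?A" unfolding p by (rule alternating_fixed_part) fact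
  have ge: "expo_ge v (- int ?N - int v) ?A" if "Suc v = ?r" for v
    using expo_ge_fixed_part[of n] that assms by simp
  have idx: "row_index n = {p..<?r}" using assms by (auto simp: row_index_def)
  have row_fillings_eq: "row_fillings ?N n = wincr p ?r 1 ?N"
    unfolding row_fillings_def wincr_def idx by auto
  have "(\<Sum>a\<in>magog_trapezoids m n k. P ^ card (magog_maxima m n k a) * Q ^ card (magog_minima n k a))
      = (\<Sum>y\<in>wincr p ?r 1 ?N. min_weight n y * Det n (entry n y))"
    using sum_magog_eq_sum_Det[of n ?N "\<lambda>_. 1"] by (simp add: weight_def row_fillings_eq)
  also have "\<dots> = (\<Sum>y\<in>wincr p ?r 1 ?N. (if y p = 1 then Q else 1) * T y)"
    using assms by (intro sum.cong refl)
      (simp add: Det_entry T_def min_weight_def atLeastLessThanSuc_atLeastAtMost Suc_diff_le)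
  also have "\<dots> = (\<Sum>y\<in>{y \<in> wincr p ?r 1 ?N. y p = 1}. (if y p = 1 then Q else 1) * T y)
      + (\<Sum>y\<in>{y \<in> wincr p ?r 1 ?N. y p \<noteq> 1}. (if y p = 1 then Q else 1) * T y)"
    by (subst sum.union_disjoint[symmetric]) (auto simp: finite_wincr intro!: sum.cong)
  also have "(\<Sum>y\<in>{y \<in> wincr p ?r 1 ?N. y p = 1}. (if y p = 1 then Q else 1) * T y)
      = Q * (\<Sum>y\<in>{y \<in> wincr p ?r 1 ?N. y p = 1}. T y)"
    by (simp add: sum_distrib_left)
  also have "(\<Sum>y\<in>{y \<in> wincr p ?r 1 ?N. y p \<noteq> 1}. (if y p = 1 then Q else 1) * T y)
      = (\<Sum>y\<in>{y \<in> wincr p ?r 1 ?N. y p \<noteq> 1}. T y)"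
    by (intro sum.cong) auto
  also have "{y \<in> wincr p ?r 1 ?N. y p \<noteq> 1} = wincr p ?r 2 ?N"
    using wincr_rest[OF pr(1), of 1 ?N] by (simp add: numeral_2_eq_2)
  also have "(\<Sum>y\<in>wincr p ?r 2 ?N. T y) = const_term (?A * free_series p ?r 2)"
    unfolding T_def by (rule sum_wincr_alternating) (use pr alt ge in auto)
  also have "(\<Sum>y\<in>{y \<in> wincr p ?r 1 ?N. y p = 1}. T y)
      = (\<Sum>z\<in>wincr (Suc p) ?r 1 ?N. T (z(p := 1)))"
    by (rule sum_wincr_first) (use assms in auto)
  also have "\<dots> = (\<Sum>z\<in>wincr (Suc p) ?r 1 ?N. const_term (?A * upow p (1 + int p)
      * (\<Prod>j\<in>{Suc p..<?r}. upow j (int (z j) + int j))))"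
  proof (rule sum.cong[OF refl])
    fix z
    have "(\<Prod>j\<in>{p..<?r}. upow j (int ((z(p := 1)) j) + int j))
      = upow p (1 + int p) * (\<Prod>j\<in>{Suc p..<?r}. upow j (int (z j) + int j) :: 'a mlaurent)"
      unfolding prod.atLeast_Suc_lessThan[OF pr(1)]
      by (intro arg_cong2[of _ _ _ _ "(*)"] prod.cong) auto
    then show "T (z(p := 1)) = const_term (?A * upow p (1 + int p)
      * (\<Prod>j\<in>{Suc p..<?r}. upow j (int (z j) + int j)))"
      unfolding T_def by (simp only: mult.assoc)
  qed
  also have "\<dots> = const_term (?A * upow p (1 + int p) * free_series (Suc p) ?r 1)"
  proof (rule sum_wincr_alternating)
    show "alternating (Suc p) ?r (?A * upow p (1 + int p))"
      by (intro alternating_mult[OF alternating_Suc] symmetric_in_upow alt) auto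
    show "expo_ge v (- int ?N - int v) (?A * upow p (1 + int p))" if "Suc v = ?r" "Suc p \<le> v" for v
      by (intro expo_ge_mult0 ge expo_ge_upow) (use that in auto)
  qed (use pr in auto)
  also have "?A * upow p (1 + int p) * free_series (Suc p) ?r 1
      = ?A * (free_series p ?r 1 * ((1 - upow p 1) * (\<Prod>j\<in>{Suc p..<?r}. 1 - upow p 1 * upow j 1)))"
    unfolding free_series_first[OF pr(1)] by (simp add: mult.assoc)
  \<comment> \<open>Lowering every exponent by one passes from the start 2 to the start 1, so both
    parts share the factor \<open>free_series p ?r 2\<close>.\<close>
  also have "free_series p ?r 1 = free_series p ?r 2 * (\<Prod>j\<in>{p..<?r}. upow j (-1) :: 'a mlaurent)"
  proof -
    have "upow j (int 1 + int j) = upow j (int 2 + int j) * (upow j (-1) :: 'a mlaurent)" for j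
      by (simp flip: upow_add)
    then show ?thesis unfolding free_series_def by (simp add: prod.distrib mult_ac del: of_nat_1 of_nat_numeral)
  qed
  finally show ?thesis
    by (simp add: const_term_add[symmetric] const_term_mconst_mult[symmetric]
        atLeastLessThanSuc_atLeastAtMost algebra_simps del: of_nat_Suc)
qed

section \<open>Signs and the passage from u to x\<close>

lemma choose_two_Suc: "(Suc n + 1) choose 2 = ((n + 1) choose 2) + (n + 1)"
  by (simp add: numeral_2_eq_2)

text \<open>For m = 0 the exponent is (n + 1 choose 2) - n, which is still nonnegative, so
  \<open>nat\<close> cuts nothing off.\<close>

lemma prod_signs:
  "(\<Prod>a=1..n. (-1 :: 'a::comm_ring_1) ^ (m + a + 1))
    = (-1) ^ nat ((int m - 1) * int n + int ((n + 1) choose 2))"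
proof -
  have le: "n \<le> (n + 1) choose 2"
  proof (induction n)
    case (Suc n)
    then show ?case unfolding choose_two_Suc by simp
  qed simp
  have "(int m - 1) * int n + int ((n + 1) choose 2)
      = int (m * n) + (int ((n + 1) choose 2) - int n)" by (simp add: algebra_simps)
  then have nonneg: "0 \<le> (int m - 1) * int n + int ((n + 1) choose 2)" using le by linarith
  have "(\<Prod>a=1..n. (-1 :: 'a) ^ (m + a + 1)) = (-1) ^ (m * n + n + ((n + 1) choose 2))"
  proof (induction n)
    case (Suc n)
    then show ?case unfolding choose_two_Suc by (simp add: power_add algebra_simps)
  qed (simp add: numeral_2_eq_2)
  moreover have "even (m * n + n + ((n + 1) choose 2))
      \<longleftrightarrow> even (nat ((int m - 1) * int n + int ((n + 1) choose 2)))"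
    using nonneg by (simp add: even_nat_iff) blast
  ultimately show ?thesis by (simp only: minus_one_power_iff)
qed

lemma xpow_eq_upow: "xpow i z = (-1) ^ nat \<bar>z\<bar> * upow i z"
  by (simp add: upow_def flip: mult.assoc power_add)

theorem theorem4p3:
  fixes m n k :: nat
  assumes "1 \<le> k" and "k \<le> n"
  shows
    "(\<Sum>a \<in> magog_trapezoids m n k.
        indetP ^ card (magog_maxima m n k a) * indetQ ^ card (magog_minima n k a)) =
     const_term (
       (-1) ^ nat ((int m - 1) * int n + int ((n + 1) choose 2))
       * ((-1) ^ k * mconst indetQ * (1 + xpow (n - k + 1) (-1))
            * (\<Prod>j = n - k + 2..n. xpow j (-1) - xvar (n - k + 1)) + 1)
       * (\<Prod>i = 1..n - k. inv_one_plus i ^ (i + k) * xpow i (- int m - 2 * int n + int i + 1)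
            * (xvar i - mconst indetP * (1 + xvar i)) * (xvar i - mconst indetQ * (1 + xvar i)))
       * (\<Prod>i = n - k + 1..n. inv_one_plus i ^ (n + 1) * xpow i (- int m - 2 * int n + int i + 2)
            * (xvar i - mconst indetP * (1 + xvar i)))
       * (\<Prod>i = 1..n. \<Prod>j = i + 1..n. (xvar i - xvar j) * (xvar i + xvar j + xvar i * xvar j))
       * (\<Prod>i = n - k + 1..n. \<Prod>j = i + 1..n. inv_one_minus_prod i j))"
proof -
  interpret magog_weights indetP indetQ m k by unfold_locales fact
  define p where "p = n - k + 1"
  have p: "n - k + 2 = p + 1" "p \<le> n" "k = n - p + 1" using assms by (auto simp: p_def)
  have hP: "xvar i - mconst indetP * (1 + xvar i) = - hP i" for i
    by (simp add: hP_def upow_1)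
  have hQ: "xvar i - mconst indetQ * (1 + xvar i) = - hQ i" for i
    by (simp add: hQ_def upow_1)
  define s where "s i = (-1 :: int poly poly mlaurent) ^ (m + i + 1)" for i
  have s1: "(-1) ^ nat \<bar>- int m - 2 * int n + int i + 1\<bar> = s i" for i
    by (simp add: s_def minus_one_power_iff even_nat_iff)
  have s2: "(-1) ^ nat \<bar>- int m - 2 * int n + int i + 2\<bar> = - s i" for i
    by (simp add: s_def minus_one_power_iff even_nat_iff)

  \<comment> \<open>Each of the k factors 1 + x_p^(-1) and x_j^(-1) - x_p brings a minus sign when
    written in u, which uses up (-1)^k.\<close>
  have boundary: "(-1) ^ k * mconst indetQ * (1 + xpow p (-1)) * (\<Prod>j=p + 1..n. xpow j (-1) - xvar p)
      = mconst indetQ * (\<Prod>j=p..n. upow j (-1)) * (1 - upow p 1) * (\<Prod>j=p + 1..n. 1 - upow p 1 * upow j 1)"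
  proof -
    have inv: "upow j (-1) * upow j 1 = (1 :: int poly poly mlaurent)" for j
      by (simp flip: upow_add)
    have "xpow j (-1) - xvar p = - (upow j (-1) * (1 - upow p 1 * upow j 1) :: int poly poly mlaurent)" for j
    proof -
      have "upow j (-1) * (1 - upow p 1 * upow j 1) = upow j (-1) - (upow j (-1) * upow j 1) * (upow p 1 :: int poly poly mlaurent)"
        by (simp add: algebra_simps)
      then show ?thesis unfolding inv by (simp add: xpow_eq_upow)
    qed
    then have "(\<Prod>j=p + 1..n. xpow j (-1) - xvar p :: int poly poly mlaurent)
        = (-1) ^ (n - p) * ((\<Prod>j=p + 1..n. upow j (-1)) * (\<Prod>j=p + 1..n. 1 - upow p 1 * upow j 1))"
      by (simp add: prod_uminus prod.distrib)
    moreover have "1 + xpow p (-1) = - (upow p (-1) * (1 - upow p 1) :: int poly poly mlaurent)"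
      by (simp add: right_diff_distrib inv xpow_eq_upow)
    moreover have "(\<Prod>j=p..n. upow j (-1)) = upow p (-1) * (\<Prod>j=p + 1..n. upow j (-1) :: int poly poly mlaurent)"
      using p by (simp add: prod.atLeast_Suc_atMost)
    moreover have "(-1) ^ k = - ((-1) ^ (n - p) :: int poly poly mlaurent)"
      unfolding p(3) by simp
    moreover have "(-1) ^ (n - p) * ((-1) ^ (n - p) * c) = (c :: int poly poly mlaurent)" for c
      by (simp flip: mult.assoc power_add)
    ultimately show ?thesis by (simp add: mult_ac)
  qed
  have left: "(\<Prod>i=1..n - k. inv_one_plus i ^ (i + k) * xpow i (- int m - 2 * int n + int i + 1)
        * (xvar i - mconst indetP * (1 + xvar i)) * (xvar i - mconst indetQ * (1 + xvar i)))
      = (\<Prod>i=1..n - k. s i) * (\<Prod>a=1..n - k. hP a * hQ a * inv_one_plus a ^ (a + k)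
          * upow a (1 + int a - int m - 2 * int n))"
    unfolding hP hQ xpow_eq_upow[of _ "- int m - 2 * int n + _ + 1"] s1 prod.distrib[symmetric]
    by (intro prod.cong refl) (simp add: algebra_simps)
  have right: "(\<Prod>i=p..n. inv_one_plus i ^ (n + 1) * xpow i (- int m - 2 * int n + int i + 2)
        * (xvar i - mconst indetP * (1 + xvar i)))
      = (\<Prod>i=p..n. s i) * (\<Prod>a=p..n. hP a * inv_one_plus a ^ n * upow a (- int m - 2 * int n))
        * (\<Prod>j=p..n. upow j (int 2 + int j) * inv_one_plus j)"
    unfolding prod.distrib[symmetric]
  proof (intro prod.cong refl)
    fix i
    have "upow i (- int m - 2 * int n + int i + 2)
        = upow i (- int m - 2 * int n) * (upow i (int 2 + int i) :: int poly poly mlaurent)"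
      by (simp add: algebra_simps flip: upow_add)
    then show "inv_one_plus i ^ (n + 1) * xpow i (- int m - 2 * int n + int i + 2)
        * (xvar i - mconst indetP * (1 + xvar i))
      = s i * (hP i * inv_one_plus i ^ n * upow i (- int m - 2 * int n))
        * (upow i (int 2 + int i) * inv_one_plus i)"
      unfolding hP xpow_eq_upow[of _ "- int m - 2 * int n + _ + 2"] s2 by (simp add: mult_ac)
  qed
  have sign: "(-1) ^ nat ((int m - 1) * int n + int ((n + 1) choose 2))
      = (\<Prod>i=1..n - k. s i) * (\<Prod>i=p..n. s i)"
    unfolding p_def prod_split_at[OF assms(2), symmetric] s_def by (rule prod_signs[symmetric])
  \<comment> \<open>Every sign occurs twice, in the prefactor and in the products over the
    variables.\<close>
  have sq: "(\<Prod>i\<in>X. s i) * ((\<Prod>i\<in>X. s i) * c) = c" for X c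
  proof -
    have "s i * s i = 1" for i by (simp add: s_def flip: power_add)
    then show ?thesis by (simp flip: mult.assoc prod.distrib)
  qed
  have free: "free_series p (Suc n) 2 = (\<Prod>j=p..n. upow j (int 2 + int j) * inv_one_plus j)
      * (\<Prod>i=p..n. \<Prod>j=i + 1..n. inv_one_minus_prod i j :: int poly poly mlaurent)"
    by (simp add: free_series_def atLeastLessThanSuc_atLeastAtMost)
  show ?thesis
    unfolding magog_generating_function[OF assms p_def] p(1) p_def[symmetric] boundary left right
      sign free fixed_part_def varprod_def[symmetric]
    by (rule arg_cong[of _ _ const_term]) (simp only: mult_ac sq)
qed

end
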